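(* Let $\varepsilon\in\{1,-1\}$, $k\ge0$ an integer, $\gamma\in\Gamma$, $\tau\in\mathbb H$, and define for $x\in\mathbb R^2$ \[ r^{\varepsilon}_k(\gamma,\tau;x)=\Big(h_x\,\big|^{-\varepsilon}_{2k+1}\,(T^{-1}-I)(1+V+\dots+V^{l-1})\gamma\Big)(\tau),\qquad h_x(\tau)=\frac{e^{i\pi\tau|x|^2}}{(i\pi\tau)^k}. \] Then $x\mapsto r^\varepsilon_k(\gamma,\tau;x)$ satisfies $\mathcal F\big(r^\varepsilon_k(\gamma,\tau;\cdot)\big)=\varepsilon\,r^\varepsilon_k(\gamma,\tau;\cdot)$, and for every integer $n\ge0$, $\frac{d^k}{du^k}r^\varepsilon_k\big(\gamma,\tau;\sqrt{2n/\lambda}\big)=0$.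
   Context: Fix an integer $l\ge6$ with $l\equiv2\pmod4$, $\lambda=2\cos(\pi/l)$, $\mathbb H$ the upper half-plane, $S=\begin{pmatrix}0&1\\-1&0\end{pmatrix}$, $T=\begin{pmatrix}1&\lambda\\0&1\end{pmatrix}$ acting by Möbius transformations, $\Gamma$ the group generated by $S,T$ (Hecke triangle group $(2,l,\infty)$), $V=TS$, $I$ the identity. For an odd integer $m$ and $\eta\in\{\pm1\}$, the slash operator $|^{\eta}_m$ is the right action of $\Gamma$ on functions $h:\mathbb H\to\mathbb C$ determined by $(h|^{\eta}_mS)(\tau)=\eta(i/\tau)^m h(-1/\tau)$, $(h|^\eta_mT)(\tau)=h(\tau+\lambda)$ and $h|(\gamma_1\gamma_2)=(h|\gamma_1)|\gamma_2$, extended linearly to the group ring $\mathbb Z[\Gamma]$. The Fourier transform in $x\in\mathbb R^2$ is $\mathcal F(f)(\xi)=\int_{\mathbb R^2}f(x)e^{2\pi i\langle x,\xi\rangle}dx$. The function $r^\varepsilon_k$ is radial in $x$; with $u=|x|^2$, $\frac{d^k}{du^k}g(\sqrt t)$ for radial $g(x)=G(|x|^2)$ means $G^{(k)}(t)$. *)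

theory Defs
  imports
    "HOL-Analysis.Analysis"
    "HOL-Algebra.Generated_Groups"
    "HOL-Library.Poly_Mapping"
begin

section \<open>Hecke triangle groups\<close>

typedef uhp = "{z::complex. Im z > 0}"
  morphisms of_uhp to_uhp
  by (rule exI[of _ \<i>]) simp

text \<open>A monoid record on matrices is needed because the type-class power on
  \<open>real^2^2\<close> is not the matrix power.\<close>

definition SL2R :: "(real^2^2) monoid" where
  "SL2R = \<lparr>carrier = {A. det A = 1}, mult = (**), one = mat 1\<rparr>"

definition hecke_lambda :: "nat \<Rightarrow> real" where
  "hecke_lambda l = 2 * cos (pi / real l)"

definition hecke_S :: "real^2^2" where
  "hecke_S = vector [vector [0, 1], vector [-1, 0]]"

definition hecke_T :: "nat \<Rightarrow> real^2^2" where
  "hecke_T l = vector [vector [1, hecke_lambda l], vector [0, 1]]"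

definition hecke_V :: "nat \<Rightarrow> real^2^2" where
  "hecke_V l = hecke_T l ** hecke_S"

text \<open>The group is taken inside the matrices, not modulo \<open>-I = S\<^sup>2\<close>; the slash
  action below is trivial on \<open>-I\<close>, so it also is an action of the image in
  the group of Moebius transformations.\<close>

definition hecke_group :: "nat \<Rightarrow> (real^2^2) set" where
  "hecke_group l = generate SL2R {hecke_S, hecke_T l}"


section \<open>The slash action\<close>

text \<open>\<open>act \<gamma> h\<close> stands for \<open>h | \<gamma>\<close>; the multiplicativity axiom is that of a right action.
  Extensionality only fixes the irrelevant values outside the group.\<close>

definition is_slash_action ::
  "nat \<Rightarrow> complex \<Rightarrow> int \<Rightarrow> (real^2^2 \<Rightarrow> (uhp \<Rightarrow> complex) \<Rightarrow> uhp \<Rightarrow> complex) \<Rightarrow> bool" where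
  "is_slash_action l \<eta> m act \<longleftrightarrow>
     act \<in> extensional (hecke_group l) \<and>
     (\<forall>h. act (mat 1) h = h) \<and>
     (\<forall>\<gamma>1\<in>hecke_group l. \<forall>\<gamma>2\<in>hecke_group l. \<forall>h. act (\<gamma>1 ** \<gamma>2) h = act \<gamma>2 (act \<gamma>1 h)) \<and>
     (\<forall>h \<tau>. act hecke_S h \<tau> = \<eta> * (\<i> / of_uhp \<tau>) powi m * h (to_uhp (- 1 / of_uhp \<tau>))) \<and>
     (\<forall>h \<tau>. act (hecke_T l) h \<tau> = h (to_uhp (of_uhp \<tau> + of_real (hecke_lambda l))))"

text \<open>Existence and uniqueness, for \<open>l \<equiv> 2\<close> modulo 4, odd \<open>m\<close> and \<open>\<eta> = \<plusminus>1\<close>, is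
  lemma \<open>ex1_slash_action\<close> at the end of this theory.\<close>

definition slash ::
  "nat \<Rightarrow> complex \<Rightarrow> int \<Rightarrow> real^2^2 \<Rightarrow> (uhp \<Rightarrow> complex) \<Rightarrow> uhp \<Rightarrow> complex" where
  "slash l \<eta> m = (THE act. is_slash_action l \<eta> m act)"

text \<open>Elements of the group ring are finitely supported integer functions. The library product
  of \<open>\<Rightarrow>\<^sub>0\<close> needs additive notation for the keys, hence the explicit convolution.\<close>

definition gr_mult :: "(real^2^2 \<Rightarrow>\<^sub>0 int) \<Rightarrow> (real^2^2 \<Rightarrow>\<^sub>0 int) \<Rightarrow> (real^2^2 \<Rightarrow>\<^sub>0 int)"
    (infixl \<open>\<star>\<close> 70) where
  "a \<star> b = (\<Sum>x\<in>Poly_Mapping.keys a. \<Sum>y\<in>Poly_Mapping.keys b.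
     Poly_Mapping.single (x ** y) (Poly_Mapping.lookup a x * Poly_Mapping.lookup b y))"

abbreviation gr_of :: "real^2^2 \<Rightarrow> (real^2^2 \<Rightarrow>\<^sub>0 int)" where
  "gr_of g \<equiv> Poly_Mapping.single g 1"

definition slash_ring ::
  "nat \<Rightarrow> complex \<Rightarrow> int \<Rightarrow> (real^2^2 \<Rightarrow>\<^sub>0 int) \<Rightarrow> (uhp \<Rightarrow> complex) \<Rightarrow> uhp \<Rightarrow> complex" where
  "slash_ring l \<eta> m a h \<tau> =
     (\<Sum>g\<in>Poly_Mapping.keys a. of_int (Poly_Mapping.lookup a g) * slash l \<eta> m g h \<tau>)"


section \<open>The functions \<open>r\<close>, Fourier transform and radial derivatives\<close>

definition gauss_fun :: "nat \<Rightarrow> real^2 \<Rightarrow> uhp \<Rightarrow> complex" where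
  "gauss_fun k x \<tau> =
     exp (\<i> * of_real pi * of_uhp \<tau> * of_real ((norm x)\<^sup>2)) / (\<i> * of_real pi * of_uhp \<tau>) ^ k"

definition r_fun :: "nat \<Rightarrow> complex \<Rightarrow> nat \<Rightarrow> real^2^2 \<Rightarrow> uhp \<Rightarrow> real^2 \<Rightarrow> complex" where
  "r_fun l \<epsilon> k \<gamma> \<tau> x =
     slash_ring l (- \<epsilon>) (2 * int k + 1)
       ((gr_of (inv\<^bsub>SL2R\<^esub> (hecke_T l)) - gr_of (mat 1))
        \<star> (\<Sum>j<l. gr_of (hecke_V l [^]\<^bsub>SL2R\<^esub> j))
        \<star> gr_of \<gamma>)
       (gauss_fun k x) \<tau>"

definition fourier2 :: "(real^2 \<Rightarrow> complex) \<Rightarrow> real^2 \<Rightarrow> complex" where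
  "fourier2 f \<xi> = (LINT x|lborel. f x * exp (2 * of_real pi * \<i> * of_real (x \<bullet> \<xi>)))"

text \<open>\<open>has_radial_deriv k g t d\<close>: \<open>g\<close> is radial, \<open>g x = G (|x|\<^sup>2)\<close>, its profile \<open>G\<close> is \<open>k\<close> times
  differentiable on the half line, and \<open>d\<close> is its \<open>k\<close>-th derivative at \<open>t \<ge> 0\<close>. Here \<open>D j\<close> is the
  \<open>j\<close>-th derivative of \<open>G = D 0\<close>. Since \<open>G\<close> is only determined by \<open>g\<close> on \<open>t \<ge> 0\<close>, the
  derivative at \<open>0\<close> is one-sided.\<close>

definition has_radial_deriv :: "nat \<Rightarrow> (real^2 \<Rightarrow> complex) \<Rightarrow> real \<Rightarrow> complex \<Rightarrow> bool" where
  "has_radial_deriv k g t d \<longleftrightarrow>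
     (\<exists>D :: nat \<Rightarrow> real \<Rightarrow> complex.
        (\<forall>x. g x = D 0 ((norm x)\<^sup>2)) \<and>
        (\<forall>j<k. \<forall>s\<ge>0. (D j has_vector_derivative D (Suc j) s) (at s within {0..})) \<and>
        D k t = d)"

section \<open>The slash action is well defined\<close>

definition m2 :: "real \<Rightarrow> real \<Rightarrow> real \<Rightarrow> real \<Rightarrow> real^2^2" where
  "m2 a b c d = vector [vector [a, b], vector [c, d]]"

lemma m2_nth [simp]:
  "m2 a b c d $ 1 $ 1 = a" "m2 a b c d $ 1 $ 2 = b"
  "m2 a b c d $ 2 $ 1 = c" "m2 a b c d $ 2 $ 2 = d"
  by (simp_all add: m2_def)

lemma m2_eq_iff [simp]: "m2 a b c d = m2 a' b' c' d' \<longleftrightarrow> a = a' \<and> b = b' \<and> c = c' \<and> d = d'"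
  by (metis m2_nth)

lemma m2_exhaust: obtains a b c d where "A = m2 a b c d"
proof
  show "A = m2 (A$1$1) (A$1$2) (A$2$1) (A$2$2)"
    by (simp add: vec_eq_iff forall_2)
qed

lemma m2_mult [simp]: "m2 a b c d ** m2 a' b' c' d' =
    m2 (a * a' + b * c') (a * b' + b * d') (c * a' + d * c') (c * b' + d * d')"
  by (simp add: vec_eq_iff forall_2 matrix_matrix_mult_def sum_2)

lemma m2_scaleR [simp]: "r *\<^sub>R m2 a b c d = m2 (r * a) (r * b) (r * c) (r * d)"
  by (simp add: vec_eq_iff forall_2)

lemma m2_one: "mat 1 = m2 1 0 0 1"
  by (simp add: vec_eq_iff forall_2 mat_def)

lemma m2_det [simp]: "det (m2 a b c d) = a * d - b * c"
  by (simp add: det_2)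

lemma hecke_S_m2: "hecke_S = m2 0 1 (-1) 0"
  by (simp add: hecke_S_def m2_def)

lemma hecke_T_m2: "hecke_T l = m2 1 (hecke_lambda l) 0 1"
  by (simp add: hecke_T_def m2_def)

lemma SL2R_simps [simp]:
  "carrier SL2R = {A. det A = 1}" "mult SL2R = (**)" "one SL2R = mat 1"
  by (simp_all add: SL2R_def)

lemma group_SL2R: "group SL2R"
proof (rule groupI)
  fix A assume "A \<in> carrier SL2R"
  then have "det A = 1" by simp
  obtain a b c d where A: "A = m2 a b c d" by (rule m2_exhaust)
  show "\<exists>B\<in>carrier SL2R. B \<otimes>\<^bsub>SL2R\<^esub> A = \<one>\<^bsub>SL2R\<^esub>"
    using \<open>det A = 1\<close>
    by (intro bexI[of _ "m2 d (-b) (-c) a"]) (auto simp: A m2_one algebra_simps)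
qed (auto simp: det_mul matrix_mul_assoc)

lemma inv_m2: "a * d - b * c = 1 \<Longrightarrow> inv\<^bsub>SL2R\<^esub> (m2 a b c d) = m2 d (-b) (-c) a"
  by (intro group.inv_equality[OF group_SL2R]) (auto simp: m2_one algebra_simps)

lemma hecke_group_det: "\<gamma> \<in> hecke_group l \<Longrightarrow> det \<gamma> = 1"
  using group.generate_in_carrier[OF group_SL2R, of "{hecke_S, hecke_T l}" \<gamma>]
  by (simp add: hecke_group_def hecke_S_m2 hecke_T_m2)

text \<open>Words in the generators, together with the multiplier that the slash action attaches to
  them; \<open>s\<close> is the multiplier of \<open>S\<close>.\<close>

inductive hecke_word :: "nat \<Rightarrow> complex \<Rightarrow> real^2^2 \<Rightarrow> complex \<Rightarrow> bool" for l s where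
  one: "hecke_word l s (mat 1) 1"
| S: "hecke_word l s g c \<Longrightarrow> hecke_word l s (g ** hecke_S) (c * s)"
| T: "hecke_word l s g c \<Longrightarrow> hecke_word l s (g ** hecke_T l) c"
| T': "hecke_word l s g c \<Longrightarrow> hecke_word l s (g ** m2 1 (- hecke_lambda l) 0 1) c"

lemma hecke_word_mult:
  "hecke_word l s h d \<Longrightarrow> hecke_word l s g c \<Longrightarrow> hecke_word l s (g ** h) (c * d)"
proof (induction rule: hecke_word.induct)
  case one
  then show ?case by simp
next
  case (S h d)
  then show ?case using hecke_word.S[of l s "g ** h" "c * d"] by (simp add: matrix_mul_assoc mult.assoc)
next
  case (T h d)
  then show ?case using hecke_word.T[of l s "g ** h" "c * d"] by (simp add: matrix_mul_assoc)
next
  case (T' h d)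
  then show ?case using hecke_word.T'[of l s "g ** h" "c * d"] by (simp add: matrix_mul_assoc)
qed

lemma hecke_word_gens:
  "hecke_word l s hecke_S s" "hecke_word l s (hecke_T l) 1"
  "hecke_word l s (m2 1 (- hecke_lambda l) 0 1) 1"
  using hecke_word.intros(2-4)[OF hecke_word.one, of l s] by simp_all

lemma hecke_word_S': 
  assumes "s\<^sup>2 = -1" shows "hecke_word l s (m2 0 (-1) 1 0) (1 / s)"
proof -
  have "hecke_word l s (hecke_S ** hecke_S ** hecke_S) (s * s * s)"
    by (intro hecke_word_mult hecke_word_gens)
  moreover have "s * s = -1" "s \<noteq> 0" using assms by (auto simp: power2_eq_square)
  then have "s * s * s = 1 / s" by (simp add: eq_divide_eq)
  ultimately show ?thesis by (simp add: hecke_S_m2)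
qed

lemma hecke_word_inv:
  assumes s: "s\<^sup>2 = -1" and "hecke_word l s g c"
  shows "c \<noteq> 0 \<and> (\<exists>g'. hecke_word l s g' (1 / c) \<and> g ** g' = mat 1)"
  using assms(2)
proof (induction rule: hecke_word.induct)
  case one
  then show ?case using hecke_word.one[of l s] by auto
next
  case (S g c)
  then obtain g' where g': "c \<noteq> 0" "hecke_word l s g' (1 / c)" "g ** g' = mat 1" by auto
  have "s \<noteq> 0" using s by auto
  have "hecke_word l s (m2 0 (-1) 1 0 ** g') (1 / s * (1 / c))"
    by (intro hecke_word_mult hecke_word_S' g' s)
  moreover have "g ** hecke_S ** (m2 0 (-1) 1 0 ** g') = g ** (hecke_S ** m2 0 (-1) 1 0) ** g'"
    by (simp only: matrix_mul_assoc)
  moreover have "\<dots> = mat 1"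
    using g' by (simp add: hecke_S_m2 flip: m2_one)
  ultimately show ?case using g' \<open>s \<noteq> 0\<close>
    by (intro conjI exI[of _ "m2 0 (-1) 1 0 ** g'"]) (simp_all add: mult.commute)
next
  case (T g c)
  then obtain g' where g': "c \<noteq> 0" "hecke_word l s g' (1 / c)" "g ** g' = mat 1" by auto
  have "hecke_word l s (m2 1 (- hecke_lambda l) 0 1 ** g') (1 * (1 / c))"
    by (intro hecke_word_mult hecke_word_gens g')
  moreover have "g ** hecke_T l ** (m2 1 (- hecke_lambda l) 0 1 ** g')
      = g ** (hecke_T l ** m2 1 (- hecke_lambda l) 0 1) ** g'"
    by (simp only: matrix_mul_assoc)
  moreover have "\<dots> = mat 1"
    using g' by (simp add: hecke_T_m2 flip: m2_one)
  ultimately show ?case using g' 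
    by (intro conjI exI[of _ "m2 1 (- hecke_lambda l) 0 1 ** g'"]) simp_all
next
  case (T' g c)
  then obtain g' where g': "c \<noteq> 0" "hecke_word l s g' (1 / c)" "g ** g' = mat 1" by auto
  have "hecke_word l s (hecke_T l ** g') (1 * (1 / c))"
    by (intro hecke_word_mult hecke_word_gens g')
  moreover have "g ** m2 1 (- hecke_lambda l) 0 1 ** (hecke_T l ** g')
      = g ** (m2 1 (- hecke_lambda l) 0 1 ** hecke_T l) ** g'"
    by (simp only: matrix_mul_assoc)
  moreover have "\<dots> = mat 1"
    using g' by (simp add: hecke_T_m2 flip: m2_one)
  ultimately show ?case using g' 
    by (intro conjI exI[of _ "hecke_T l ** g'"]) simp_all
qed

text \<open>Powers of \<open>U = -TS\<close> have entries \<open>sin (j\<pi>/l) / sin (\<pi>/l)\<close>.\<close>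

definition sq :: "nat \<Rightarrow> real \<Rightarrow> real" where
  "sq l x = sin (x * pi / real l) / sin (pi / real l)"

definition Upow :: "nat \<Rightarrow> nat \<Rightarrow> real^2^2" where
  "Upow l j = m2 (sq l (real j + 1)) (- sq l (real j)) (sq l (real j)) (- sq l (real j - 1))"

lemma sq_rec: "sq l (x + 1) = hecke_lambda l * sq l x - sq l (x - 1)"
proof -
  have "sin ((x + 1) * pi / real l) + sin ((x - 1) * pi / real l)
      = 2 * cos (pi / real l) * sin (x * pi / real l)"
    by (simp add: ring_distribs add_divide_distrib diff_divide_distrib sin_add sin_diff)
  then have "sin ((x + 1) * pi / real l)
      = 2 * cos (pi / real l) * sin (x * pi / real l) - sin ((x - 1) * pi / real l)" by simp
  then show ?thesis by (simp add: sq_def hecke_lambda_def diff_divide_distrib)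
qed

lemma sin_pi_div_pos: "l \<ge> 2 \<Longrightarrow> sin (pi / real l) > 0"
  by (intro sin_gt_zero) (auto simp: field_simps)

lemma sq_pos: "l \<ge> 2 \<Longrightarrow> 0 < x \<Longrightarrow> x < real l \<Longrightarrow> sq l x > 0"
  unfolding sq_def
  by (intro divide_pos_pos sin_gt_zero sin_pi_div_pos) (auto simp: field_simps)

lemma sq_simps:
  assumes "l \<ge> 2"
  shows "sq l 0 = 0" "sq l 1 = 1" "sq l (-1) = -1" "sq l (real l) = 0"
    "sq l (real l - 1) = 1" "sq l (real l + 1) = -1"
proof -
  have "sin (pi / real l) \<noteq> 0" using sin_pi_div_pos[OF assms] by simp
  then show "sq l 0 = 0" "sq l 1 = 1" "sq l (-1) = -1" "sq l (real l) = 0"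
    "sq l (real l - 1) = 1" "sq l (real l + 1) = -1"
    using assms
    by (simp_all add: sq_def ring_distribs add_divide_distrib diff_divide_distrib sin_add sin_diff)
qed

lemma sq_nonneg: "l \<ge> 2 \<Longrightarrow> 0 \<le> x \<Longrightarrow> x \<le> real l \<Longrightarrow> sq l x \<ge> 0"
  using sq_pos[of l x] sq_simps[of l] by (cases "x = 0 \<or> x = real l") auto

lemma Upow_0: "l \<ge> 2 \<Longrightarrow> Upow l 0 = mat 1"
  by (simp add: Upow_def sq_simps m2_one)

lemma Upow_l: "l \<ge> 2 \<Longrightarrow> Upow l l = (-1) *\<^sub>R mat 1"
  by (simp add: Upow_def sq_simps m2_one)

lemma Upow_1: "l \<ge> 2 \<Longrightarrow> Upow l 1 = m2 (hecke_lambda l) (-1) 1 0"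
  using sq_rec[of l 1] by (simp add: Upow_def sq_simps)

lemma Upow_Suc: "l \<ge> 2 \<Longrightarrow> Upow l j ** Upow l 1 = Upow l (Suc j)"
  unfolding Upow_1 using sq_rec[of l "real j"] sq_rec[of l "real j + 1"]
  by (simp add: Upow_def algebra_simps)

text \<open>Products of the nonnegative matrices \<open>U\<^sup>j S\<close>, \<open>0 < j < l\<close>.\<close>

inductive pos_word :: "nat \<Rightarrow> complex \<Rightarrow> real^2^2 \<Rightarrow> complex \<Rightarrow> bool" for l s where
  one: "pos_word l s (mat 1) 1"
| step: "pos_word l s p c \<Longrightarrow> 0 < j \<Longrightarrow> j < l \<Longrightarrow>
    pos_word l s (p ** (Upow l j ** hecke_S)) (c * ((- s) ^ j * s))"

lemma Upow_S: "Upow l j ** hecke_S =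
    m2 (sq l (real j)) (sq l (real j + 1)) (sq l (real j - 1)) (sq l (real j))"
  by (simp add: Upow_def hecke_S_m2)

lemma pos_word_entries:
  assumes "pos_word l s p c" "l \<ge> 3"
  shows "p = mat 1 \<and> c = 1 \<or>
    p$1$1 > 0 \<and> p$2$2 > 0 \<and> p$1$2 \<ge> 0 \<and> p$2$1 \<ge> 0 \<and> p$1$2 + p$2$1 > 0"
  using assms(1)
proof (induction rule: pos_word.induct)
  case one
  then show ?case by simp
next
  case (step p c j)
  obtain w x y z where p: "p = m2 w x y z" by (rule m2_exhaust)
  have *: "w > 0" "z > 0" "x \<ge> 0" "y \<ge> 0"
    using step.IH by (auto simp: p m2_one)
  have j: "sq l (real j) > 0" "sq l (real j + 1) \<ge> 0" "sq l (real j - 1) \<ge> 0"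
    using step.hyps assms(2) by (auto intro!: sq_pos sq_nonneg)
  have "sq l (real j + 1) > 0 \<or> sq l (real j - 1) > 0"
  proof (cases "j = 1")
    case True
    then show ?thesis using assms(2) by (auto intro!: sq_pos)
  next
    case False
    then show ?thesis using assms(2) step.hyps by (intro disjI2 sq_pos) auto
  qed
  then have "w * sq l (real j + 1) + z * sq l (real j - 1) > 0"
    using * j by (auto intro: add_pos_nonneg add_nonneg_pos)
  then have "(w * sq l (real j + 1) + z * sq l (real j - 1)) + (x * sq l (real j) + y * sq l (real j)) > 0"
    by (rule add_pos_nonneg) (use * j in simp)
  moreover have "w * sq l (real j) + x * sq l (real j - 1) > 0"
    "y * sq l (real j + 1) + z * sq l (real j) > 0"
    using * j by (simp_all add: add_pos_nonneg add_nonneg_pos)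
  moreover have "w * sq l (real j + 1) + x * sq l (real j) \<ge> 0"
    "y * sq l (real j) + z * sq l (real j - 1) \<ge> 0"
    using * j by simp_all
  ultimately show ?case
    unfolding p Upow_S by (intro disjI2) (simp add: algebra_simps)
qed

text \<open>Normal form \<open>\<delta> S\<^sup>e p U\<^sup>b\<close>.\<close>

definition nform :: "nat \<Rightarrow> complex \<Rightarrow> real^2^2 \<Rightarrow> complex \<Rightarrow> bool" where
  "nform l s g c \<longleftrightarrow> (\<exists>\<delta> e p cp b. (\<delta> = 1 \<or> \<delta> = -1) \<and> pos_word l s p cp \<and> b < l \<and>
     g = \<delta> *\<^sub>R ((if e then hecke_S else mat 1) ** p ** Upow l b) \<and>
     c = of_real \<delta> * ((if e then s else 1) * cp * (- s) ^ b))"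

lemma nformI: 
  assumes "\<delta> = 1 \<or> \<delta> = -1" "pos_word l s p cp" "b < l"
    "g = \<delta> *\<^sub>R ((if e then hecke_S else mat 1) ** p ** Upow l b)"
    "c = of_real \<delta> * ((if e then s else 1) * cp * (- s) ^ b)"
  shows "nform l s g c"
  unfolding nform_def using assms by (intro exI[of _ \<delta>] exI[of _ e] exI[of _ p] exI[of _ cp] exI[of _ b]) auto

lemma scale_mult: "((r::real) *\<^sub>R A) ** B = r *\<^sub>R (A ** (B::real^2^2))" "A ** (r *\<^sub>R B) = r *\<^sub>R (A ** B)"
    "A ** (- B) = - (A ** B)"
  by (simp_all add: vec_eq_iff forall_2 matrix_matrix_mult_def sum_2 algebra_simps)

lemma hecke_SS: "hecke_S ** hecke_S = (-1) *\<^sub>R mat 1"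
  by (simp add: hecke_S_m2 m2_one)

lemma nform_S:
  assumes "l \<ge> 3" and s: "s\<^sup>2 = -1" and "nform l s g c"
  shows "nform l s (g ** hecke_S) (c * s)"
proof -
  obtain \<delta> e p cp b where *: "\<delta> = 1 \<or> \<delta> = (-1::real)" "pos_word l s p cp" "b < l"
    "g = \<delta> *\<^sub>R ((if e then hecke_S else mat 1) ** p ** Upow l b)"
    "c = of_real \<delta> * ((if e then s else 1) * cp * (- s) ^ b)"
    using assms(3) unfolding nform_def by blast
  have ss: "s * s = -1" using s by (simp add: power2_eq_square)
  have ss': "s * (s * z) = - z" for z using ss by (metis mult.assoc mult_minus1)
  have U0: "Upow l 0 = mat 1" using assms by (simp add: Upow_0)
  show ?thesis
  proof (cases "b = 0")
    case False
    have "pos_word l s (p ** (Upow l b ** hecke_S)) (cp * ((- s) ^ b * s))"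
      using * False by (intro pos_word.step) auto
    then show ?thesis using * assms(1)
      by (intro nformI[of \<delta> l s _ _ 0 _ e])
        (auto simp: U0 scale_mult matrix_mul_assoc)
  next
    case True
    note b0 = True
    from *(2) show ?thesis
    proof cases
      case one
      show ?thesis
      proof (cases e)
        case True
        then show ?thesis using * assms(1) b0 one
          by (intro nformI[of "-\<delta>" l s "mat 1" 1 0 _ False])
            (auto simp: U0 scale_mult hecke_SS ss intro: pos_word.one)
      next
        case False
        then show ?thesis using * assms(1) b0 one
          by (intro nformI[of "\<delta>" l s "mat 1" 1 0 _ True])
            (auto simp: U0 scale_mult  intro: pos_word.one)
      qed
    next
      case (step q cq j)
      have "(if e then hecke_S else mat 1) ** (q ** (Upow l j ** hecke_S)) ** hecke_S
        = (if e then hecke_S else mat 1) ** q ** Upow l j ** (hecke_S ** hecke_S)"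
        by (simp add: matrix_mul_assoc)
      then have "g ** hecke_S = (- \<delta>) *\<^sub>R ((if e then hecke_S else mat 1) ** q ** Upow l j)"
        using * b0 step by (simp add: U0 scale_mult hecke_SS)
      then show ?thesis using * step assms(1) b0
        by (intro nformI[of "-\<delta>" l s q cq j _ e])
          (auto simp: algebra_simps ss ss')
    qed
  qed
qed

lemma nform_U:
  assumes "l \<ge> 3" and l: "(- s) ^ l = -1" and "nform l s g c"
  shows "nform l s (g ** Upow l 1) (c * (- s))"
proof -
  obtain \<delta> e p cp b where *: "\<delta> = 1 \<or> \<delta> = (-1::real)" "pos_word l s p cp" "b < l"
    "g = \<delta> *\<^sub>R ((if e then hecke_S else mat 1) ** p ** Upow l b)"
    "c = of_real \<delta> * ((if e then s else 1) * cp * (- s) ^ b)"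
    using assms(3) unfolding nform_def by blast
  have "(if e then hecke_S else mat 1) ** p ** Upow l b ** Upow l 1 = 
      (if e then hecke_S else mat 1) ** p ** (Upow l b ** Upow l 1)"
    by (simp only: matrix_mul_assoc)
  then have g: "g ** Upow l 1 = \<delta> *\<^sub>R ((if e then hecke_S else mat 1) ** p ** Upow l (Suc b))"
    using * Upow_Suc[of l b] assms(1) by (simp add: scale_mult)
  show ?thesis
  proof (cases "Suc b = l")
    case False
    then show ?thesis using * g
      by (intro nformI[of \<delta> l s p cp "Suc b" _ e]) auto
  next
    case True
    have "(- s) ^ Suc b = -1" using l True by simp
    then have "c * (- s) = of_real (-\<delta>) * ((if e then s else 1) * cp)"
      using * by (simp add: algebra_simps)
    then show ?thesis using * g True assms(1) Upow_l[of l]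
      by (intro nformI[of "-\<delta>" l s p cp 0 _ e]) (auto simp: scale_mult Upow_0)
  qed
qed

lemma nform_neg:
  assumes "nform l s g c" shows "nform l s ((-1) *\<^sub>R g) (- c)"
proof -
  obtain \<delta> e p cp b where *: "\<delta> = 1 \<or> \<delta> = (-1::real)" "pos_word l s p cp" "b < l"
    "g = \<delta> *\<^sub>R ((if e then hecke_S else mat 1) ** p ** Upow l b)"
    "c = of_real \<delta> * ((if e then s else 1) * cp * (- s) ^ b)"
    using assms unfolding nform_def by blast
  then show ?thesis by (intro nformI[of "-\<delta>" l s p cp b _ e]) auto
qed

lemma nform_Upow:
  assumes "l \<ge> 3" and l: "(- s) ^ l = -1" and "nform l s g c"
  shows "nform l s (g ** Upow l j) (c * (- s) ^ j)"
proof (induction j)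
  case 0
  then show ?case using assms by (simp add: Upow_0)
next
  case (Suc j)
  have "g ** Upow l j ** Upow l 1 = g ** Upow l (Suc j)"
    using Upow_Suc[of l j] assms(1) by (simp flip: matrix_mul_assoc)
  then show ?case using nform_U[OF assms(1,2) Suc] by (simp add: algebra_simps)
qed

lemma hecke_word_nform:
  assumes l: "l \<ge> 3" and s: "s\<^sup>2 = -1" and sl: "(- s) ^ l = -1"
    and "hecke_word l s g c"
  shows "nform l s g c"
  using assms(4)
proof (induction rule: hecke_word.induct)
  case one
  show ?case using l by (intro nformI[of 1 l s "mat 1" 1 0 _ False]) (auto simp: Upow_0 pos_word.one)
next
  case (S g c)
  then show ?case using nform_S[OF l s] by simp
next
  case (T g c)
  have "Upow l 1 ** hecke_S = hecke_T l"
    using l by (simp add: Upow_1[of l, simplified] hecke_S_m2 hecke_T_m2)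
  then have "g ** Upow l 1 ** hecke_S = g ** hecke_T l" 
    by (simp flip: matrix_mul_assoc)
  then show ?case using nform_S[OF l s nform_U[OF l sl T.IH]] s
    by (simp add: power2_eq_square mult.assoc)
next
  case (T' g c)
  have "hecke_S ** Upow l (l - 1) = m2 1 (- hecke_lambda l) 0 1"
    using l sq_rec[of l "real l - 1"] by (simp add: Upow_def hecke_S_m2 sq_simps of_nat_diff)
  then have "g ** hecke_S ** Upow l (l - 1) = g ** m2 1 (- hecke_lambda l) 0 1" 
    by (simp flip: matrix_mul_assoc)
  moreover have "s * (- s) ^ (l - 1) = 1"
    using sl l by (cases l) auto
  ultimately show ?case using nform_Upow[OF l sl nform_S[OF l s T'.IH], of "l - 1"]
    by (simp add: mult.assoc)
qed

lemma nform_one: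
  assumes l: "l \<ge> 3" and "nform l s (mat 1) c" 
  shows "c = 1"
proof -
  obtain \<delta> e p cp b where *: "\<delta> = 1 \<or> \<delta> = (-1::real)" "pos_word l s p cp" "b < l"
    "mat 1 = \<delta> *\<^sub>R ((if e then hecke_S else mat 1) ** p ** Upow l b)"
    "c = of_real \<delta> * ((if e then s else 1) * cp * (- s) ^ b)"
    using assms unfolding nform_def by blast
  obtain w x y z where p: "p = m2 w x y z" by (rule m2_exhaust)
  have pos: "w > 0" "z > 0" "x \<ge> 0" "y \<ge> 0" and alt: "p = mat 1 \<and> cp = 1 \<or> x + y > 0"
    using pos_word_entries[OF *(2) l] by (auto simp: p m2_one)
  have \<delta>0: "\<delta> \<noteq> 0" using * by auto
  have b0: "sq l (real b) \<ge> 0" "sq l (real b + 1) \<ge> 0"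
    using * l by (auto intro!: sq_nonneg)
  have b1: "sq l (real b) > 0" "sq l (real b - 1) \<ge> 0" if "b \<noteq> 0"
    using * l that by (auto intro!: sq_pos sq_nonneg)
  show ?thesis
  proof (cases e)
    case False
    then have eq: "m2 1 0 0 1 = \<delta> *\<^sub>R (m2 w x y z ** Upow l b)"
      using * p m2_one by simp
    have "b = 0"
    proof (rule ccontr)
      assume "b \<noteq> 0"
      have "w * sq l (real b) + x * sq l (real b - 1) > 0"
        using b1[OF \<open>b \<noteq> 0\<close>] pos by (intro add_pos_nonneg) auto
      moreover have "w * sq l (real b) + x * sq l (real b - 1) = 0"
        using eq \<delta>0 by (auto simp: Upow_def)
      ultimately show False by simp
    qed
    then have eq: "m2 1 0 0 1 = \<delta> *\<^sub>R m2 w x y z"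
      using eq l by (simp add: Upow_0)
    then have "x = 0" "y = 0" "w * \<delta> = 1" using \<delta>0 by (auto simp: mult.commute)
    then have "p = mat 1" "cp = 1" "\<delta> = 1" using alt * pos by (auto simp: p m2_one)
    then show ?thesis using * False \<open>b = 0\<close> by simp
  next
    case True
    then have eq: "m2 1 0 0 1 = \<delta> *\<^sub>R (hecke_S ** m2 w x y z ** Upow l b)"
      using * p m2_one by simp
    then have 1: "y * sq l (real b) + z * sq l (real b - 1) = 0" 
      and 2: "w * sq l (real b + 1) + x * sq l (real b) = 0"
      using \<delta>0 by (auto simp: Upow_def hecke_S_m2)
    have "w * sq l (real b + 1) = 0"
      using 2 pos b0 by (metis add_nonneg_eq_0_iff less_imp_le mult_nonneg_nonneg)
    then have A: "sq l (real b + 1) = 0" using pos by simp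
    have False
    proof (cases "b = 0")
      case True
      then show False using A l by (simp add: sq_simps)
    next
      case False
      have "z * sq l (real b - 1) = 0"
        using 1 pos b0 b1[OF False] by (metis add_nonneg_eq_0_iff less_imp_le mult_nonneg_nonneg)
      then have "sq l (real b - 1) = 0" using pos by simp
      then have "\<not> real b - 1 > 0" using sq_pos[of l "real b - 1"] l * by auto
      then have "b = 1" using False by simp
      then show False using A sq_pos[of l 2] l by simp
    qed
    then show ?thesis ..
  qed
qed

lemma hecke_word_unique:
  assumes l: "l \<ge> 3" and s: "s\<^sup>2 = -1" and sl: "(- s) ^ l = -1"
    and "hecke_word l s g c" "hecke_word l s g c'"
  shows "c = c'"
proof -
  obtain g' where g': "c \<noteq> 0" "hecke_word l s g' (1 / c)" "g ** g' = mat 1"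
    using hecke_word_inv[OF s assms(4)] by auto
  have "hecke_word l s (mat 1) (c' * (1 / c))"
    using hecke_word_mult[OF g'(2) assms(5)] g' by simp
  then have "c' * (1 / c) = 1"
    using nform_one[OF l hecke_word_nform[OF l s sl]] by blast
  then show ?thesis using g' by (simp add: field_simps)
qed

lemma hecke_word_exists:
  assumes s: "s\<^sup>2 = -1" and "g \<in> hecke_group l"
  shows "\<exists>c. hecke_word l s g c"
  using assms(2) unfolding hecke_group_def
proof (induction rule: generate.induct)
  case one
  then show ?case using hecke_word.one by auto
next
  case (incl h)
  then show ?case using hecke_word_gens[of l s] by blast
next
  case (inv h)
  then show ?case using hecke_word_gens(3)[of l s] hecke_word_S'[OF s, of l]
    by (auto simp: hecke_S_m2 hecke_T_m2 inv_m2)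
next
  case (eng h1 h2)
  then show ?case using hecke_word_mult by (metis SL2R_simps(2))
qed

text \<open>The Moebius action and its automorphy factor.\<close>

definition jfac :: "real^2^2 \<Rightarrow> uhp \<Rightarrow> complex" where
  "jfac g \<tau> = of_real (g$2$1) * of_uhp \<tau> + of_real (g$2$2)"

definition mob :: "real^2^2 \<Rightarrow> uhp \<Rightarrow> uhp" where
  "mob g \<tau> = to_uhp ((of_real (g$1$1) * of_uhp \<tau> + of_real (g$1$2)) / jfac g \<tau>)"

lemma of_uhp_Im: "Im (of_uhp \<tau>) > 0"
  using of_uhp[of \<tau>] by simp

lemma jfac_nonzero: "det g = 1 \<Longrightarrow> jfac g \<tau> \<noteq> 0"
proof
  assume g: "det g = 1" and j: "jfac g \<tau> = 0"
  obtain a b c d where m: "g = m2 a b c d" by (rule m2_exhaust)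
  have "c * Im (of_uhp \<tau>) = 0" "c * Re (of_uhp \<tau>) + d = 0"
    using arg_cong[OF j, of Im] arg_cong[OF j, of Re] by (simp_all add: jfac_def m)
  then have "c = 0" "d = 0" using of_uhp_Im[of \<tau>] by auto
  then show False using g m by simp
qed

lemma of_uhp_mob:
  assumes "det g = 1"
  shows "of_uhp (mob g \<tau>) = (of_real (g$1$1) * of_uhp \<tau> + of_real (g$1$2)) / jfac g \<tau>"
proof -
  obtain a b c d where m: "g = m2 a b c d" by (rule m2_exhaust)
  define t where "t = of_uhp \<tau>"
  have j: "of_real c * t + of_real d \<noteq> 0"
    using jfac_nonzero[OF assms, of \<tau>] by (simp add: jfac_def m t_def)
  have "Im ((of_real a * t + of_real b) / (of_real c * t + of_real d))
      = (a * d - b * c) * Im t / (cmod (of_real c * t + of_real d))\<^sup>2"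
    unfolding Im_divide' by (simp add: algebra_simps)
  also have "\<dots> > 0" using assms m of_uhp_Im[of \<tau>] j by (simp add: t_def)
  finally show ?thesis by (simp add: mob_def m jfac_def t_def to_uhp_inverse)
qed

lemma jfac_mult:
  assumes "det g = 1" "det h = 1"
  shows "jfac (g ** h) \<tau> = jfac g (mob h \<tau>) * jfac h \<tau>"
proof -
  obtain a b c d where g: "g = m2 a b c d" by (rule m2_exhaust)
  obtain a' b' c' d' where h: "h = m2 a' b' c' d'" by (rule m2_exhaust)
  have "jfac g (mob h \<tau>) * jfac h \<tau> =
    of_real c * (of_real a' * of_uhp \<tau> + of_real b') + of_real d * jfac h \<tau>"
    unfolding jfac_def[of g] of_uhp_mob[OF assms(2)]
    using jfac_nonzero[OF assms(2), of \<tau>]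
    by (simp add: distrib_right g flip: h) (simp add: h)
  then show ?thesis by (simp add: jfac_def g h algebra_simps)
qed

lemma mob_mult:
  assumes "det g = 1" "det h = 1"
  shows "mob (g ** h) \<tau> = mob g (mob h \<tau>)"
proof -
  obtain a b c d where g: "g = m2 a b c d" by (rule m2_exhaust)
  obtain a' b' c' d' where h: "h = m2 a' b' c' d'" by (rule m2_exhaust)
  have gh: "det (g ** h) = 1" using assms by (simp add: det_mul)
  have nz: "jfac h \<tau> \<noteq> 0" "jfac g (mob h \<tau>) \<noteq> 0" using jfac_nonzero assms by auto
  have "of_uhp (mob g (mob h \<tau>)) =
    (of_real a * ((of_real a' * of_uhp \<tau> + of_real b') / jfac h \<tau>) + of_real b) / jfac g (mob h \<tau>)"
    by (subst of_uhp_mob[OF assms(1)], subst of_uhp_mob[OF assms(2)]) (simp add: g h)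
  also have "\<dots> = (of_real a * (of_real a' * of_uhp \<tau> + of_real b') + of_real b * jfac h \<tau>)
      / (jfac g (mob h \<tau>) * jfac h \<tau>)"
    using nz by (simp add: field_simps)
  also have "\<dots> = of_uhp (mob (g ** h) \<tau>)"
    unfolding of_uhp_mob[OF gh] jfac_mult[OF assms] 
    by (simp add: jfac_def g h algebra_simps)
  finally show ?thesis by (simp add: of_uhp_inject)
qed

lemma hecke_group_gens:
  "mat 1 \<in> hecke_group l" "hecke_S \<in> hecke_group l" "hecke_T l \<in> hecke_group l"
  "g \<in> hecke_group l \<Longrightarrow> h \<in> hecke_group l \<Longrightarrow> g ** h \<in> hecke_group l"
  using generate.one[of SL2R "{hecke_S, hecke_T l}"]
    generate.incl[of _ "{hecke_S, hecke_T l}" SL2R]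
    generate.eng[of g SL2R "{hecke_S, hecke_T l}" h]
  by (auto simp: hecke_group_def)

lemma slash_multiplier:
  assumes "l mod 4 = 2" "odd m" "\<eta> \<in> {1, -1::complex}"
  defines "s \<equiv> \<eta> * (- \<i>) powi m"
  shows "s\<^sup>2 = -1" "(- s) ^ l = -1"
proof -
  have "((- \<i>) powi m)\<^sup>2 = (-1) powi m"
    by (metis mult_minus_left mult_minus_right minus_minus power2_eq_square power_int_mult_distrib i_squared)
  also have "\<dots> = -1" using assms(2) by (simp add: power_int_minus_left_odd)
  finally show s2: "s\<^sup>2 = -1" using assms(3) by (auto simp: s_def power_mult_distrib)
  define r where "r = l div 4"
  have l: "l = 2 * (2 * r + 1)" using assms(1) unfolding r_def by presburger
  have "(- s) ^ l = (s\<^sup>2) ^ (2 * r + 1)" unfolding l by (simp only: power_mult power2_minus)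
  then show "(- s) ^ l = -1" unfolding s2 by simp
qed

lemma ex_slash_action:
  assumes "l \<ge> 6" "l mod 4 = 2" "odd m" "\<eta> \<in> {1, -1::complex}"
  shows "\<exists>act. is_slash_action l \<eta> m act"
proof -
  define s where "s = \<eta> * (- \<i>) powi m"
  have s: "s\<^sup>2 = -1" "(- s) ^ l = -1"
    using slash_multiplier[OF assms(2-4)] by (simp_all add: s_def)
  have l3: "l \<ge> 3" using assms(1) by simp
  define \<mu> where "\<mu> g = (THE c. hecke_word l s g c)" for g
  have \<mu>I: "\<mu> g = c" if "hecke_word l s g c" for g c
    unfolding \<mu>_def using hecke_word_unique[OF l3 s] that by (intro the_equality) auto
  have \<mu>W: "hecke_word l s g (\<mu> g)" if "g \<in> hecke_group l" for g
    using hecke_word_exists[OF s(1) that] \<mu>I by auto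
  define act where "act = restrict (\<lambda>g h \<tau>. \<mu> g * jfac g \<tau> powi (- m) * h (mob g \<tau>)) (hecke_group l)"
  have act: "act g h \<tau> = \<mu> g * jfac g \<tau> powi (- m) * h (mob g \<tau>)" if "g \<in> hecke_group l" for g h \<tau>
    using that by (simp add: act_def)
  show ?thesis
    unfolding is_slash_action_def
  proof (intro exI[of _ act] conjI allI ballI)
    show "act \<in> extensional (hecke_group l)" by (simp add: act_def)
    show "act (mat 1) h = h" for h
    proof
      fix \<tau>
      have "jfac (mat 1) \<tau> = 1" "mob (mat 1) \<tau> = \<tau>"
        by (simp_all add: mob_def jfac_def m2_one of_uhp_inverse)
      then show "act (mat 1) h \<tau> = h \<tau>"
        using \<mu>I[OF hecke_word.one] by (simp add: act hecke_group_gens)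
    qed
    show "act (g1 ** g2) h = act g2 (act g1 h)" if g: "g1 \<in> hecke_group l" "g2 \<in> hecke_group l" for g1 g2 h
    proof
      fix \<tau>
      have "\<mu> (g1 ** g2) = \<mu> g1 * \<mu> g2"
        by (intro \<mu>I hecke_word_mult \<mu>W g)
      then show "act (g1 ** g2) h \<tau> = act g2 (act g1 h) \<tau>"
        using g hecke_group_det[OF g(1)] hecke_group_det[OF g(2)]
        by (simp add: act hecke_group_gens jfac_mult mob_mult power_int_mult_distrib)
    qed
    show "act hecke_S h \<tau> = \<eta> * (\<i> / of_uhp \<tau>) powi m * h (to_uhp (- 1 / of_uhp \<tau>))" for h \<tau>
    proof -
      have nz: "of_uhp \<tau> \<noteq> 0" using of_uhp_Im[of \<tau>] by auto
      have "\<i> / of_uhp \<tau> = (- \<i>) * inverse (- of_uhp \<tau>)" using nz by (simp add: field_simps)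
      then have "(\<i> / of_uhp \<tau>) powi m = (- \<i>) powi m * (- of_uhp \<tau>) powi (- m)"
        by (simp only: power_int_mult_distrib power_int_inverse power_int_minus)
      moreover have "jfac hecke_S \<tau> = - of_uhp \<tau>" "mob hecke_S \<tau> = to_uhp (- 1 / of_uhp \<tau>)"
        by (simp_all add: mob_def jfac_def hecke_S_m2)
      ultimately show ?thesis
        using \<mu>I[OF hecke_word_gens(1)] by (simp add: act hecke_group_gens s_def)
    qed
    show "act (hecke_T l) h \<tau> = h (to_uhp (of_uhp \<tau> + of_real (hecke_lambda l)))" for h \<tau>
    proof -
      have "jfac (hecke_T l) \<tau> = 1"
        "mob (hecke_T l) \<tau> = to_uhp (of_uhp \<tau> + of_real (hecke_lambda l))"
        by (simp_all add: mob_def jfac_def hecke_T_m2)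
      then show ?thesis
        using \<mu>I[OF hecke_word_gens(2)] by (simp add: act hecke_group_gens)
    qed
  qed
qed

lemma slash_action_unique:
  assumes A: "is_slash_action l \<eta> m act" and B: "is_slash_action l \<eta> m act'"
  shows "act = act'"
proof (rule extensionalityI)
  show "act \<in> extensional (hecke_group l)" "act' \<in> extensional (hecke_group l)"
    using A B by (auto simp: is_slash_action_def)
  note gen = hecke_group_def[symmetric]
  have gens: "act g = act' g" if "g \<in> {hecke_S, hecke_T l}" for g
    using that A B by (auto simp: is_slash_action_def fun_eq_iff)
  have mulA: "act (g ** h) f = act h (act g f)" "act' (g ** h) f = act' h (act' g f)"
    if "g \<in> hecke_group l" "h \<in> hecke_group l" for g h f
    using that A B by (auto simp: is_slash_action_def)
  have oneA: "act (mat 1) f = f" "act' (mat 1) f = f" for f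
    using A B by (auto simp: is_slash_action_def)
  fix g assume "g \<in> hecke_group l"
  then show "act g = act' g" unfolding hecke_group_def
  proof (induction rule: generate.induct)
    case one
    then show ?case using oneA by (auto simp: fun_eq_iff)
  next
    case (incl h)
    then show ?case by (rule gens)
  next
    case (inv h)
    have h: "h \<in> carrier SL2R" using inv by (auto simp: hecke_S_m2 hecke_T_m2)
    have hi: "inv\<^bsub>SL2R\<^esub> h \<in> hecke_group l" "h \<in> hecke_group l"
      using generate.inv[OF inv] generate.incl[OF inv] by (auto simp: hecke_group_def)
    have e: "h ** inv\<^bsub>SL2R\<^esub> h = mat 1" "inv\<^bsub>SL2R\<^esub> h ** h = mat 1"
      using group.r_inv[OF group_SL2R h] group.l_inv[OF group_SL2R h] by auto
    show ?case
    proof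
      fix f
      have "act (inv\<^bsub>SL2R\<^esub> h) f = act (inv\<^bsub>SL2R\<^esub> h) (act' h (act' (inv\<^bsub>SL2R\<^esub> h) f))"
        using mulA(2)[OF hi(1,2)] oneA e by metis
      also have "\<dots> = act' (inv\<^bsub>SL2R\<^esub> h) f"
        using mulA(1)[OF hi(2,1)] oneA e gens[OF inv] by metis
      finally show "act (inv\<^bsub>SL2R\<^esub> h) f = act' (inv\<^bsub>SL2R\<^esub> h) f" .
    qed
  next
    case (eng h1 h2)
    show ?case
    proof
      fix f
      show "act (h1 \<otimes>\<^bsub>SL2R\<^esub> h2) f = act' (h1 \<otimes>\<^bsub>SL2R\<^esub> h2) f"
        using eng mulA[of h1 h2 f] by (simp add: hecke_group_def)
    qed
  qed
qed

lemma ex1_slash_action: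
  assumes "l \<ge> 6" "l mod 4 = 2" "odd m" "\<eta> \<in> {1, -1::complex}"
  shows "\<exists>!act. is_slash_action l \<eta> m act"
  using ex_slash_action[OF assms] slash_action_unique by blast

lemma slash_is_slash_action:
  assumes "l \<ge> 6" "l mod 4 = 2" "odd m" "\<eta> \<in> {1, -1::complex}"
  shows "is_slash_action l \<eta> m (slash l \<eta> m)"
  unfolding slash_def by (rule theI'[OF ex1_slash_action[OF assms]])
end

theory Submission
  imports Defs "HOL-Complex_Analysis.Conformal_Mappings" "HOL-Probability.Characteristic_Functions"
begin

text \<open>Write \<open>N = 1 + V + \<dots> + V\<^sup>l\<^sup>-\<^sup>1\<close>. The Fourier transform of the Gaussian, continued analytically
  from real to complex parameter, reads \<open>\<F>(h\<^sub>x) = -\<epsilon> h\<^sub>\<xi> | S\<close>. Since \<open>l\<close> is even, \<open>V\<^sup>l = -I\<close> acts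
  trivially, so \<open>V N = N\<close> and \<open>S N = T\<^sup>-\<^sup>1 V N = T\<^sup>-\<^sup>1 N\<close>; together with \<open>S\<^sup>2 = 1\<close> this
  gives \<open>S (T\<^sup>-\<^sup>1 - 1) N = -(T\<^sup>-\<^sup>1 - 1) N\<close>, the eigenfunction property.
  The \<open>k\<close>-th derivative turns \<open>h\<^sub>x\<close> into \<open>exp (i\<pi>\<tau>u)\<close>, which for \<open>u = 2n/\<lambda>\<close> is invariant under \<open>T\<close> and
  so is killed by \<open>T\<^sup>-\<^sup>1 - 1\<close>.\<close>

section \<open>Gaussian integrals with complex parameter\<close>

text \<open>Integrand of the one-dimensional Fourier transform at frequency \<open>\<xi>\<close>.
  The parameter \<open>a\<close> is complex because it is later set to
  \<open>- \<i> * of_real pi * t\<close> with \<open>t\<close> in the upper half-plane, which has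
  positive real part.\<close>

definition gauss1 :: "real \<Rightarrow> complex \<Rightarrow> real \<Rightarrow> complex" where
  "gauss1 \<xi> a x = exp (- (a * of_real (x\<^sup>2))) * exp (2 * of_real pi * \<i> * of_real (x * \<xi>))"

lemma norm_gauss1: "norm (gauss1 \<xi> a x) = exp (- (Re a * x\<^sup>2))"
  by (simp add: gauss1_def norm_mult norm_exp_eq_Re)

lemma gauss1_measurable [measurable]: "gauss1 \<xi> a \<in> borel_measurable borel"
  unfolding gauss1_def by measurable

lemma integrable_exp_neg_square:
  assumes "0 < \<delta>"
  shows "integrable lborel (\<lambda>x::real. exp (- (\<delta> * x\<^sup>2)))"
proof -
  have "integrable lborel (\<lambda>x. sqrt (pi / \<delta>) * normal_density 0 (sqrt (1 / (2 * \<delta>))) x)"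
    using assms by (intro integrable_mult_right integrable_normal_density) simp
  also have "(\<lambda>x. sqrt (pi / \<delta>) * normal_density 0 (sqrt (1 / (2 * \<delta>))) x) = (\<lambda>x. exp (- (\<delta> * x\<^sup>2)))"
    using assms by (auto simp: fun_eq_iff normal_density_def field_simps real_sqrt_divide real_sqrt_mult)
  finally show ?thesis .
qed

lemma integrable_gauss1:
  assumes "0 < Re a"
  shows "integrable lborel (gauss1 \<xi> a)"
  by (rule Bochner_Integration.integrable_bound[OF integrable_exp_neg_square[OF assms]])
     (simp_all add: norm_gauss1)

text \<open>Truncated integrals over [-n, n] are holomorphic by differentiation under the integral
  sign, and they converge locally uniformly because the tails are dominated by a single real
  Gaussian.\<close>

lemma integral_gauss1_holomorphic: "(\<lambda>a. LINT x|lborel. gauss1 \<xi> a x) holomorphic_on {a. 0 < Re a}"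
proof (rule holomorphic_uniform_sequence)
  show "open {a. 0 < Re a}" by (simp add: open_halfspace_Re_gt)
next
  fix n :: nat
  show "(\<lambda>a. integral (cbox (- real n) (real n)) (gauss1 \<xi> a)) holomorphic_on {a. 0 < Re a}"
  proof (rule leibniz_rule_holomorphic)
    show "((\<lambda>a. gauss1 \<xi> a t) has_field_derivative
        - of_real (t\<^sup>2) * gauss1 \<xi> a t) (at a within {a. 0 < Re a})" for a t
      unfolding gauss1_def by (auto intro!: derivative_eq_intros)
    show "gauss1 \<xi> a integrable_on cbox (- real n) (real n)" for a
      unfolding gauss1_def by (intro integrable_continuous continuous_intros)
    show "continuous_on ({a. 0 < Re a} \<times> cbox (- real n) (real n))
        (\<lambda>(a, t). - of_real (t\<^sup>2) * gauss1 \<xi> a t)"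
      unfolding gauss1_def by (auto simp: case_prod_unfold intro!: continuous_intros)
    show "convex {a. 0 < Re a}" by (simp add: convex_halfspace_Re_gt)
  qed
next
  fix a0 :: complex assume "a0 \<in> {a. 0 < Re a}"
  \<comment> \<open>With this radius, Re a \<ge> \<open>\<delta>\<close> on the whole closed ball,
    so exp (-\<open>\<delta>\<close> x^2) dominates every integrand there.\<close>
  define \<delta> where "\<delta> = Re a0 / 2"
  have \<delta>: "\<delta> > 0" using \<open>a0 \<in> _\<close> by (simp add: \<delta>_def)
  have Re_ge: "Re a \<ge> \<delta>" if "a \<in> cball a0 \<delta>" for a
    using that abs_Re_le_cmod[of "a0 - a"] by (simp add: dist_norm \<delta>_def field_simps)
  \<comment> \<open>The tail mass of the dominating Gaussian: an error bound for the truncation that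
    does not depend on \<open>a\<close>.\<close>
  define e where "e n = (LINT x|lborel. exp (- (\<delta> * x\<^sup>2)) * indicator (- {- real n..real n}) x)" for n
  have int_e: "integrable lborel (\<lambda>x. exp (- (\<delta> * x\<^sup>2)) * indicator (- {- real n..real n}) x)" for n
    by (intro integrable_real_mult_indicator integrable_exp_neg_square \<delta>) auto
  have "e \<longlonglongrightarrow> (LINT x|(lborel :: real measure). 0)"
    unfolding e_def
  proof (rule integral_dominated_convergence[OF _ _ integrable_exp_neg_square[OF \<delta>]])
    show "AE x in lborel. (\<lambda>n. exp (- (\<delta> * x\<^sup>2)) * indicator (- {- real n..real n}) x) \<longlonglongrightarrow> 0"
    proof (rule AE_I2)
      fix x :: real
      obtain N where N: "\<bar>x\<bar> \<le> real N" using real_arch_simple by blast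
      have "\<forall>\<^sub>F n in sequentially. exp (- (\<delta> * x\<^sup>2)) * indicator (- {- real n..real n}) x = 0"
        using eventually_ge_at_top[of N] by eventually_elim (use N in \<open>auto simp: indicator_def\<close>)
      then show "(\<lambda>n. exp (- (\<delta> * x\<^sup>2)) * indicator (- {- real n..real n}) x) \<longlonglongrightarrow> 0"
        by (rule tendsto_eventually)
    qed
  qed (auto simp: indicator_def)
  then have e0: "e \<longlonglongrightarrow> 0" by simp
  have bound: "norm (integral (cbox (- real n) (real n)) (gauss1 \<xi> a) - (LINT x|lborel. gauss1 \<xi> a x)) \<le> e n"
    if a: "a \<in> cball a0 \<delta>" for a n
  proof -
    have "0 < Re a" using Re_ge[OF a] \<delta> by simp
    note int = integrable_gauss1[OF this, of \<xi>]
    \<comment> \<open>Set integrability identifies the gauge integral, in which holomorphy was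
      shown, with the Lebesgue integral.\<close>
    have "set_integrable lborel {- real n..real n} (gauss1 \<xi> a)"
      using int by (auto intro: integrable_mult_indicator simp: set_integrable_def)
    then have eq: "integral (cbox (- real n) (real n)) (gauss1 \<xi> a)
        = (LINT x:{- real n..real n}|lborel. gauss1 \<xi> a x)"
      by (simp add: set_borel_integral_eq_integral)
    have "(LINT x:{- real n..real n}|lborel. gauss1 \<xi> a x) - (LINT x|lborel. gauss1 \<xi> a x)
        = (LINT x|lborel. indicator {- real n..real n} x *\<^sub>R gauss1 \<xi> a x - gauss1 \<xi> a x)"
      unfolding set_lebesgue_integral_def
      by (intro Bochner_Integration.integral_diff[symmetric] int integrable_mult_indicator) auto
    also have "norm \<dots> \<le> (LINT x|lborel. exp (- (\<delta> * x\<^sup>2)) * indicator (- {- real n..real n}) x)"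
    proof (rule Bochner_Integration.integral_norm_bound_integral)
      show "norm (indicator {- real n..real n} x *\<^sub>R gauss1 \<xi> a x - gauss1 \<xi> a x)
          \<le> exp (- (\<delta> * x\<^sup>2)) * indicator (- {- real n..real n}) x" for x
        using Re_ge[OF a] by (auto simp: indicator_def norm_gauss1 mult_right_mono)
    qed (auto intro!: int int_e Bochner_Integration.integrable_diff integrable_mult_indicator)
    finally show ?thesis unfolding eq e_def .
  qed
  have "uniform_limit (cball a0 \<delta>) (\<lambda>n a. integral (cbox (- real n) (real n)) (gauss1 \<xi> a))
      (\<lambda>a. LINT x|lborel. gauss1 \<xi> a x) sequentially"
  proof (rule uniform_limitI)
    fix r :: real assume "r > 0"
    with e0 have "\<forall>\<^sub>F n in sequentially. e n < r" by (rule order_tendstoD)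
    then show "\<forall>\<^sub>F n in sequentially. \<forall>a\<in>cball a0 \<delta>.
        dist (integral (cbox (- real n) (real n)) (gauss1 \<xi> a)) (LINT x|lborel. gauss1 \<xi> a x) < r"
      by eventually_elim (unfold dist_norm, intro ballI le_less_trans[OF bound])
  qed
  moreover have "cball a0 \<delta> \<subseteq> {a. 0 < Re a}" using Re_ge \<delta> by force
  ultimately show "\<exists>d>0. cball a0 d \<subseteq> {a. 0 < Re a} \<and>
      uniform_limit (cball a0 d) (\<lambda>n a. integral (cbox (- real n) (real n)) (gauss1 \<xi> a))
        (\<lambda>a. LINT x|lborel. gauss1 \<xi> a x) sequentially"
    using \<delta> by blast
qed

text \<open>Rescaling x by \<open>sqrt (2 * a)\<close> turns the Gaussian into the standard normal
  density, so the value is that of its characteristic function at 2 pi \<open>\<xi>\<close> /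
  \<open>sqrt (2 * a)\<close>.\<close>

lemma integral_gauss1_real:
  assumes "0 < a"
  shows "(LINT x|lborel. gauss1 \<xi> (of_real a) x) = of_real (sqrt (pi / a) * exp (- (pi\<^sup>2 * \<xi>\<^sup>2 / a)))"
proof -
  define c where "c = sqrt (2 * a)"
  have c: "c > 0" "c\<^sup>2 = 2 * a" using assms by (simp_all add: c_def)
  have "of_real (exp (- (2 * pi * \<xi> / c)\<^sup>2 / 2)) = char std_normal_distribution (2 * pi * \<xi> / c)"
    by (simp add: char_std_normal_distribution)
  also have "\<dots> = (LINT x|lborel. std_normal_density x *\<^sub>R iexp (2 * pi * \<xi> / c * x))"
    unfolding char_def by (subst integral_density) (auto simp: normal_density_nonneg)
  also have "\<dots> = c *\<^sub>R (LINT x|lborel. std_normal_density (c * x) *\<^sub>R iexp (2 * pi * \<xi> / c * (c * x)))"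
    using c lborel_integral_real_affine[of c "\<lambda>x. std_normal_density x *\<^sub>R iexp (2 * pi * \<xi> / c * x)" 0]
    by simp
  also have "(\<lambda>x. std_normal_density (c * x) *\<^sub>R iexp (2 * pi * \<xi> / c * (c * x)))
      = (\<lambda>x. of_real (1 / sqrt (2 * pi)) * gauss1 \<xi> (of_real a) x)"
  proof
    fix x
    have "std_normal_density (c * x) = 1 / sqrt (2 * pi) * exp (- (a * x\<^sup>2))"
      using c by (simp add: normal_density_def power_mult_distrib)
    moreover have "iexp (2 * pi * \<xi> / c * (c * x)) = exp (2 * of_real pi * \<i> * of_real (x * \<xi>))"
      using c by (simp add: mult_ac)
    ultimately show "std_normal_density (c * x) *\<^sub>R iexp (2 * pi * \<xi> / c * (c * x))
        = of_real (1 / sqrt (2 * pi)) * gauss1 \<xi> (of_real a) x"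
      by (simp add: gauss1_def scaleR_conv_of_real exp_of_real[symmetric])
  qed
  also have "(LINT x|lborel. of_real (1 / sqrt (2 * pi)) * gauss1 \<xi> (of_real a) x)
      = of_real (1 / sqrt (2 * pi)) * (LINT x|lborel. gauss1 \<xi> (of_real a) x)"
    by simp
  finally have "of_real (exp (- (2 * pi * \<xi> / c)\<^sup>2 / 2))
      = of_real (c / sqrt (2 * pi)) * (LINT x|lborel. gauss1 \<xi> (of_real a) x)"
    by (simp add: scaleR_conv_of_real)
  moreover have "(2 * pi * \<xi> / c)\<^sup>2 / 2 = pi\<^sup>2 * \<xi>\<^sup>2 / a"
    using assms by (simp add: power_divide power_mult_distrib c)
  moreover have "c / sqrt (2 * pi) = 1 / sqrt (pi / a)"
    using assms by (simp add: c_def real_sqrt_divide real_sqrt_mult)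
  ultimately have "complex_of_real (exp (- (pi\<^sup>2 * \<xi>\<^sup>2 / a))) = of_real (1 / sqrt (pi / a)) * (LINT x|lborel. gauss1 \<xi> (of_real a) x)"
    by simp
  then show ?thesis using assms by (simp add: field_simps)
qed

text \<open>The identity is stated for a product of two integrals so that no branch of the square
  root is needed in the analytic continuation from real \<open>a\<close>.\<close>

lemma integral_gauss1_mult:
  assumes "0 < Re a"
  shows "(LINT x|lborel. gauss1 \<xi> a x) * (LINT x|lborel. gauss1 \<zeta> a x)
    = of_real pi / a * exp (- (of_real (pi\<^sup>2 * (\<xi>\<^sup>2 + \<zeta>\<^sup>2)) / a))"
proof -
  define f where "f a = (LINT x|lborel. gauss1 \<xi> a x) * (LINT x|lborel. gauss1 \<zeta> a x)
    - of_real pi / a * exp (- (of_real (pi\<^sup>2 * (\<xi>\<^sup>2 + \<zeta>\<^sup>2)) / a))" for a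
  \<comment> \<open>\<open>f\<close> is holomorphic on a connected half-plane and vanishes on the
    positive reals, which accumulate at 1.\<close>
  have "f a = 0"
  proof (rule analytic_continuation[where S = "{a. 0 < Re a}" and U = "complex_of_real ` {0<..}" and f = f and \<xi> = 1])
    show "f holomorphic_on {a. 0 < Re a}"
      unfolding f_def by (intro holomorphic_intros integral_gauss1_holomorphic) auto
    show "open {a. 0 < Re a}" by (simp add: open_halfspace_Re_gt)
    show "connected {a. 0 < Re a}" by (simp add: convex_connected convex_halfspace_Re_gt)
    show "1 islimpt complex_of_real ` {0<..}"
    proof (rule islimptI)
      fix T :: "complex set" assume "1 \<in> T" "open T"
      then obtain r where r: "r > 0" "ball 1 r \<subseteq> T" using open_contains_ball by blast
      have "complex_of_real (1 + r / 2) \<in> ball 1 r" using r by (simp add: dist_norm)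
      moreover have "complex_of_real (1 + r / 2) \<noteq> 1" using r by (simp flip: of_real_add)
      moreover have "complex_of_real (1 + r / 2) \<in> complex_of_real ` {0<..}"
        using r by (intro imageI) simp
      ultimately show "\<exists>y\<in>complex_of_real ` {0<..}. y \<in> T \<and> y \<noteq> 1"
        using r by blast
    qed
    show "f z = 0" if z: "z \<in> complex_of_real ` {0<..}" for z
    proof -
      obtain t where t: "z = of_real t" "t > 0" using z by auto
      have "(LINT x|lborel. gauss1 \<xi> z x) * (LINT x|lborel. gauss1 \<zeta> z x)
          = of_real ((sqrt (pi / t) * sqrt (pi / t)) * (exp (- (pi\<^sup>2 * \<xi>\<^sup>2 / t)) * exp (- (pi\<^sup>2 * \<zeta>\<^sup>2 / t))))"
        unfolding t(1) integral_gauss1_real[OF t(2)] of_real_mult by (simp only: mult_ac)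
      also have "(sqrt (pi / t) * sqrt (pi / t)) * (exp (- (pi\<^sup>2 * \<xi>\<^sup>2 / t)) * exp (- (pi\<^sup>2 * \<zeta>\<^sup>2 / t)))
          = pi / t * exp (- (pi\<^sup>2 * (\<xi>\<^sup>2 + \<zeta>\<^sup>2) / t))"
        using t by (simp add: distrib_left add_divide_distrib flip: exp_add)
      finally show ?thesis by (simp add: f_def t flip: exp_of_real)
    qed
  qed (use assms in auto)
  then show ?thesis by (simp add: f_def)
qed

section \<open>From the line to the plane: Fourier transform of the two-dimensional Gaussian\<close>

lemma Basis_real_2: "(Basis :: (real^2) set) = {axis 1 1, axis 2 1}"
  by (auto simp: Basis_vec_def UNIV_2)

text \<open>\<open>lborel\<close> is the image of the product of one-dimensional Lebesgue measures
  under the coordinate map, so this is Fubini for products of functions of single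
  coordinates.\<close>

lemma integral_lborel_prod_Basis:
  fixes f :: "'a::euclidean_space \<Rightarrow> real \<Rightarrow> complex"
  assumes int: "\<And>b. b \<in> Basis \<Longrightarrow> integrable lborel (f b)"
  shows "integrable lborel (\<lambda>x. \<Prod>b\<in>Basis. f b (x \<bullet> b))" (is ?I)
    and "(LINT x|lborel. (\<Prod>b\<in>Basis. f b (x \<bullet> b))) = (\<Prod>b\<in>Basis. (LINT x|lborel. f b x))" (is ?E)
proof -
  interpret product_sigma_finite "\<lambda>b::'a. lborel :: real measure" by standard
  have [measurable]: "f b \<in> borel_measurable borel" if "b \<in> Basis" for b
    using int[OF that] by simp
  have m [measurable]: "(\<lambda>x. \<Prod>b\<in>Basis. f b (x \<bullet> b)) \<in> borel_measurable borel"
    by measurable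
  have d: "(\<lambda>g. \<Sum>b\<in>Basis. g b *\<^sub>R b) \<in> (\<Pi>\<^sub>M b\<in>Basis. lborel) \<rightarrow>\<^sub>M (borel :: 'a measure)"
    by measurable
  have eq: "(\<Prod>b\<in>Basis. f b ((\<Sum>b\<in>Basis. g b *\<^sub>R b) \<bullet> b)) = (\<Prod>b\<in>Basis. f b (g b))" for g
    by (intro prod.cong refl) simp
  show ?I
    by (subst lborel_eq, subst integrable_distr_eq[OF d m]) (simp only: eq, intro product_integrable_prod int finite_Basis)
  show ?E
    by (subst lborel_eq, subst integral_distr[OF d m]) (simp only: eq, intro product_integral_prod int finite_Basis)
qed

text \<open>Gaussian and character both factor over the two coordinates. The plane yields a product
  of exactly two one-dimensional integrals, hence the factor \<open>\<i> / t\<close> without a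
  square root.\<close>

lemma gauss_fourier:
  fixes \<xi> :: "real^2"
  assumes "0 < Im t"
  defines "g \<equiv> \<lambda>x::real^2. exp (\<i> * of_real pi * t * of_real ((norm x)\<^sup>2))
      * exp (2 * of_real pi * \<i> * of_real (x \<bullet> \<xi>))"
  shows "integrable lborel g"
    and "integral\<^sup>L lborel g = \<i> / t * exp (\<i> * of_real pi * (- 1 / t) * of_real ((norm \<xi>)\<^sup>2))"
proof -
  define a where "a = - \<i> * of_real pi * t"
  have a: "0 < Re a" using assms(1) by (simp add: a_def)
  have t: "t \<noteq> 0" using assms(1) by auto
  have n2: "(norm x)\<^sup>2 = (x $ 1)\<^sup>2 + (x $ 2)\<^sup>2" for x :: "real^2"
    by (simp add: norm_vec_def L2_set_def sum_2)
  have ax: "axis 1 1 \<noteq> (axis 2 1 :: real^2)" by (simp add: axis_eq_axis)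
  have ip: "x \<bullet> axis i 1 = x $ i" for x :: "real^2" and i by (simp add: inner_axis)
  have dot: "x \<bullet> \<xi> = x $ 1 * \<xi> $ 1 + x $ 2 * \<xi> $ 2" for x by (simp add: inner_vec_def sum_2)
  have g: "g = (\<lambda>x. \<Prod>b\<in>Basis. gauss1 (\<xi> \<bullet> b) a (x \<bullet> b))"
    by (auto simp: fun_eq_iff g_def gauss1_def Basis_real_2 ax ip dot n2 a_def ring_distribs
          simp flip: exp_add) (simp add: algebra_simps)
  show "integrable lborel g"
    unfolding g by (intro integral_lborel_prod_Basis integrable_gauss1 a)
  have "integral\<^sup>L lborel g = (\<Prod>b\<in>Basis. (LINT x|lborel. gauss1 (\<xi> \<bullet> b) a x))"
    unfolding g by (intro integral_lborel_prod_Basis integrable_gauss1 a)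
  also have "\<dots> = (LINT x|lborel. gauss1 (\<xi> $ 1) a x) * (LINT x|lborel. gauss1 (\<xi> $ 2) a x)"
    by (simp add: Basis_real_2 ax inner_axis)
  also have "\<dots> = of_real pi / a * exp (- (of_real (pi\<^sup>2 * (norm \<xi>)\<^sup>2) / a))"
    by (simp only: integral_gauss1_mult[OF a] n2)
  also have "of_real pi / a = \<i> / t" using t by (simp add: a_def field_simps)
  also have "- (of_real (pi\<^sup>2 * (norm \<xi>)\<^sup>2) / a) = \<i> * of_real pi * (- 1 / t) * of_real ((norm \<xi>)\<^sup>2)"
    using t by (simp add: a_def field_simps power2_eq_square)
  finally show "integral\<^sup>L lborel g = \<i> / t * exp (\<i> * of_real pi * (- 1 / t) * of_real ((norm \<xi>)\<^sup>2))" .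
qed

section \<open>The action of the group ring\<close>

lemma hecke_V_m2: "hecke_V l = m2 (- hecke_lambda l) 1 (-1) 0"
  by (simp add: hecke_V_def hecke_T_m2 hecke_S_m2)

text \<open>V = -U for the matrix U = -TS, whose powers \<open>Upow\<close> are explicit.\<close>

lemma hecke_V_pow:
  assumes "l \<ge> 2"
  shows "hecke_V l [^]\<^bsub>SL2R\<^esub> j = (-1) ^ j *\<^sub>R Upow l j"
proof (induction j)
  case 0
  then show ?case using assms by (simp add: Upow_0)
next
  case (Suc j)
  have "hecke_V l = (-1) *\<^sub>R Upow l 1"
    unfolding Upow_1[OF assms] by (simp add: hecke_V_m2)
  then have "hecke_V l [^]\<^bsub>SL2R\<^esub> Suc j = ((-1) ^ j *\<^sub>R Upow l j) ** ((-1) *\<^sub>R Upow l 1)"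
    using Suc by simp
  also have "\<dots> = (-1) ^ Suc j *\<^sub>R (Upow l j ** Upow l 1)"
    by (simp add: vec_eq_iff matrix_matrix_mult_def sum_2 forall_2 algebra_simps)
  finally show ?case by (simp only: Upow_Suc[OF assms])
qed

lemma hecke_V_in_group: "hecke_V l \<in> hecke_group l"
  by (simp add: hecke_V_def hecke_group_gens)

lemma hecke_V_pow_in_group: "hecke_V l [^]\<^bsub>SL2R\<^esub> (j::nat) \<in> hecke_group l"
  by (induction j) (simp_all add: hecke_group_gens hecke_V_in_group)

lemma hecke_T_inv_in_group: "inv\<^bsub>SL2R\<^esub> (hecke_T l) \<in> hecke_group l"
  unfolding hecke_group_def by (intro generate.inv) simp

text \<open>Multiplicativity of the action is available only inside the group, so the supports of
  all group ring products have to be kept there.\<close>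

lemma keys_gr_mult:
  assumes "Poly_Mapping.keys a \<subseteq> hecke_group l" "Poly_Mapping.keys b \<subseteq> hecke_group l"
  shows "Poly_Mapping.keys (a \<star> b) \<subseteq> hecke_group l"
proof -
  have "Poly_Mapping.keys (Poly_Mapping.single (x ** y) c) \<subseteq> hecke_group l"
    if "x \<in> Poly_Mapping.keys a" "y \<in> Poly_Mapping.keys b" for x y and c :: int
    using that assms by (auto split: if_splits intro: hecke_group_gens)
  then show ?thesis
    unfolding gr_mult_def by (intro order_trans[OF keys_sum] UN_least)
qed

lemma of_uhp_to_uhp_S: "of_uhp (to_uhp (- 1 / of_uhp \<tau>)) = - 1 / of_uhp \<tau>"
proof -
  have "jfac hecke_S \<tau> = - of_uhp \<tau>" by (simp add: jfac_def hecke_S_m2)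
  then show ?thesis using of_uhp_mob[of hecke_S \<tau>] by (simp add: mob_def hecke_S_m2)
qed

lemma of_uhp_to_uhp_add: "of_uhp (to_uhp (of_uhp \<tau> + of_real c)) = of_uhp \<tau> + of_real c"
  using of_uhp_Im[of \<tau>] by (intro to_uhp_inverse) simp

lemma of_uhp_nonzero: "of_uhp \<tau> \<noteq> 0"
  using of_uhp_Im[of \<tau>] by auto

section \<open>The slash action of single group elements\<close>

locale hecke_slash =
  fixes l :: nat and \<eta> :: complex and m :: int
  assumes l: "l \<ge> 6" "l mod 4 = 2" and m: "odd m" and eta: "\<eta> \<in> {1, -1}"
begin

abbreviation "act \<equiv> slash l \<eta> m"
abbreviation "ract \<equiv> slash_ring l \<eta> m"

lemma act_one: "act (mat 1) h = h"
  and act_mult: "g1 \<in> hecke_group l \<Longrightarrow> g2 \<in> hecke_group l \<Longrightarrow> act (g1 ** g2) h = act g2 (act g1 h)"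
  and act_S: "act hecke_S h \<tau> = \<eta> * (\<i> / of_uhp \<tau>) powi m * h (to_uhp (- 1 / of_uhp \<tau>))"
  and act_T: "act (hecke_T l) h \<tau> = h (to_uhp (of_uhp \<tau> + of_real (hecke_lambda l)))"
  using slash_is_slash_action[OF l m eta] unfolding is_slash_action_def by blast+

text \<open>The two factors i/\<open>\<tau>\<close> and i/(-1/\<open>\<tau>\<close>) multiply to 1,
  and so do the two signs \<open>\<eta>\<close>. Thus the matrix S^2 = -I acts trivially.\<close>

lemma act_SS: "act hecke_S (act hecke_S h) = h"
proof
  fix \<tau>
  have "(\<i> / of_uhp \<tau>) powi m * (\<i> / (- 1 / of_uhp \<tau>)) powi m = 1"
    using of_uhp_nonzero[of \<tau>] by (simp flip: power_int_mult_distrib)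
  moreover have "\<eta> * \<eta> = 1" using eta by auto
  moreover have "act hecke_S (act hecke_S h) \<tau>
      = (\<eta> * \<eta>) * ((\<i> / of_uhp \<tau>) powi m * (\<i> / (- 1 / of_uhp \<tau>)) powi m) * h \<tau>"
    unfolding act_S of_uhp_to_uhp_S by (simp add: of_uhp_inverse)
  ultimately show "act hecke_S (act hecke_S h) \<tau> = h \<tau>" by simp
qed

lemma act_minus_one: "act ((-1) *\<^sub>R mat 1) h = h"
proof -
  have "(-1) *\<^sub>R mat 1 = hecke_S ** hecke_S" by (simp add: hecke_S_m2 m2_one)
  then show ?thesis by (simp only: act_mult hecke_group_gens act_SS)
qed

lemma act_T_T_inv: "act (hecke_T l) (act (inv\<^bsub>SL2R\<^esub> (hecke_T l)) h) = h"
proof -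
  have "hecke_T l \<in> carrier SL2R" by (simp add: hecke_T_m2)
  then have "inv\<^bsub>SL2R\<^esub> (hecke_T l) ** hecke_T l = mat 1"
    using group.l_inv[OF group_SL2R] by fastforce
  then show ?thesis
    using act_mult[OF hecke_T_inv_in_group hecke_group_gens(3), of h] by (simp add: act_one)
qed

lemma act_T_inv: "act (inv\<^bsub>SL2R\<^esub> (hecke_T l)) h \<tau> = h (to_uhp (of_uhp \<tau> - of_real (hecke_lambda l)))"
proof -
  have "of_uhp (to_uhp (of_uhp \<tau> - of_real (hecke_lambda l))) = of_uhp \<tau> - of_real (hecke_lambda l)"
    using of_uhp_to_uhp_add[of \<tau> "- hecke_lambda l"] by simp
  then show ?thesis
    using fun_cong[OF act_T_T_inv, of h "to_uhp (of_uhp \<tau> - of_real (hecke_lambda l))"]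
    by (simp add: act_T of_uhp_inverse)
qed

text \<open>Being a scalar times evaluation at one point, both independent of \<open>h\<close>,
  holds for the generators and their inverses and survives composition. Linearity of the action and
  its interchange with integrals and derivatives all rest on this.\<close>

lemma act_pointwise:
  assumes "g \<in> hecke_group l"
  shows "\<exists>c \<sigma>. \<forall>h. act g h \<tau> = c * h \<sigma>"
  using assms unfolding hecke_group_def
proof (induction arbitrary: \<tau> rule: generate.induct)
  case one
  show ?case by (rule exI[of _ 1]) (auto simp: act_one)
next
  case (incl g)
  then consider "g = hecke_S" | "g = hecke_T l" by blast
  then show ?case
  proof cases
    case 1 then show ?thesis by (auto simp: act_S)
  next
    case 2 then show ?thesis by (intro exI[of _ 1]) (auto simp: act_T)
  qed
next
  case (inv g)
  then consider "g = hecke_S" | "g = hecke_T l" by blast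
  then show ?case
  proof cases
    case 1
    \<comment> \<open>Since S^2 acts trivially, the inverse of S acts like S itself.\<close>
    have "inv\<^bsub>SL2R\<^esub> hecke_S = hecke_S ** hecke_S ** hecke_S"
      by (simp add: hecke_S_m2 inv_m2)
    then have "act (inv\<^bsub>SL2R\<^esub> g) h = act hecke_S h" for h
      by (simp add: 1 act_mult hecke_group_gens act_SS)
    then show ?thesis by (auto simp: act_S)
  next
    case 2 then show ?thesis by (intro exI[of _ 1]) (auto simp: act_T_inv)
  qed
next
  case (eng g1 g2)
  \<comment> \<open>The hypothesis for \<open>g1\<close> is used at the point
    \<open>\<sigma>2\<close> that \<open>g2\<close> produces, which is why the induction keeps
    \<open>\<tau>\<close> arbitrary.\<close>
  obtain c2 \<sigma>2 where 2: "\<And>h. act g2 h \<tau> = c2 * h \<sigma>2" using eng.IH(2) by blast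
  obtain c1 \<sigma>1 where 1: "\<And>h. act g1 h \<sigma>2 = c1 * h \<sigma>1" using eng.IH(1) by blast
  have "act (g1 \<otimes>\<^bsub>SL2R\<^esub> g2) h \<tau> = (c2 * c1) * h \<sigma>1" for h
    using eng.hyps by (simp add: act_mult hecke_group_def[symmetric] 1 2)
  then show ?case by blast
qed

lemma act_sum:
  assumes "g \<in> hecke_group l"
  shows "act g (\<lambda>\<sigma>. \<Sum>i\<in>I. c i * f i \<sigma>) \<tau> = (\<Sum>i\<in>I. c i * act g (f i) \<tau>)"
proof -
  obtain d \<sigma> where "\<And>h. act g h \<tau> = d * h \<sigma>" using act_pointwise[OF assms] by blast
  then show ?thesis by (simp add: sum_distrib_left mult_ac)
qed

section \<open>Linearity and multiplicativity of the group ring action\<close>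

text \<open>Cancellation can shrink the support of a sum; summing over a common finite superset
  makes additivity a termwise matter.\<close>

lemma ract_superset:
  assumes "finite K" "Poly_Mapping.keys a \<subseteq> K"
  shows "ract a h \<tau> = (\<Sum>g\<in>K. of_int (Poly_Mapping.lookup a g) * act g h \<tau>)"
  unfolding slash_ring_def
  using assms by (intro sum.mono_neutral_left) (auto simp: in_keys_iff)

lemma ract_add: "ract (a + b) h \<tau> = ract a h \<tau> + ract b h \<tau>"
proof -
  define K where "K = Poly_Mapping.keys a \<union> Poly_Mapping.keys b"
  have K: "finite K" "Poly_Mapping.keys a \<subseteq> K" "Poly_Mapping.keys b \<subseteq> K" "Poly_Mapping.keys (a + b) \<subseteq> K"
    using Poly_Mapping.keys_add[of a b] by (auto simp: K_def)
  show ?thesis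
    by (simp add: ract_superset[OF K(1)] K(2-4) lookup_add distrib_right sum.distrib)
qed

lemma ract_zero: "ract 0 h \<tau> = 0"
  by (simp add: slash_ring_def)

lemma ract_diff: "ract (a - b) h \<tau> = ract a h \<tau> - ract b h \<tau>"
  using ract_add[of "a - b" b h \<tau>] by simp

lemma ract_sum: "ract (\<Sum>i\<in>I. a i) h \<tau> = (\<Sum>i\<in>I. ract (a i) h \<tau>)"
  by (induction I rule: infinite_finite_induct) (simp_all add: ract_zero ract_add)

lemma ract_single: "ract (Poly_Mapping.single g c) h \<tau> = of_int c * act g h \<tau>"
  by (simp add: slash_ring_def)

text \<open>Expanding the convolution and swapping the two sums leaves multiplicativity on group
  elements and linearity of each \<open>act y\<close>.\<close>

lemma ract_mult:
  assumes "Poly_Mapping.keys a \<subseteq> hecke_group l" "Poly_Mapping.keys b \<subseteq> hecke_group l"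
  shows "ract (a \<star> b) h = ract b (ract a h)"
proof
  fix \<tau>
  have "ract (a \<star> b) h \<tau> = (\<Sum>x\<in>Poly_Mapping.keys a. \<Sum>y\<in>Poly_Mapping.keys b.
      of_int (Poly_Mapping.lookup a x * Poly_Mapping.lookup b y) * act y (act x h) \<tau>)"
    unfolding gr_mult_def ract_sum ract_single
    using assms by (intro sum.cong refl) (subst act_mult; blast)
  also have "\<dots> = (\<Sum>y\<in>Poly_Mapping.keys b. of_int (Poly_Mapping.lookup b y) *
      (\<Sum>x\<in>Poly_Mapping.keys a. of_int (Poly_Mapping.lookup a x) * act y (act x h) \<tau>))"
    by (subst sum.swap) (simp add: sum_distrib_left mult_ac)
  also have "\<dots> = (\<Sum>y\<in>Poly_Mapping.keys b. of_int (Poly_Mapping.lookup b y) * act y (ract a h) \<tau>)"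
  proof (intro sum.cong refl arg_cong2[where f = "(*)"])
    fix y assume "y \<in> Poly_Mapping.keys b"
    then have "y \<in> hecke_group l" using assms by blast
    then show "(\<Sum>x\<in>Poly_Mapping.keys a. of_int (Poly_Mapping.lookup a x) * act y (act x h) \<tau>) = act y (ract a h) \<tau>"
      unfolding slash_ring_def[of _ _ _ a, abs_def] by (simp add: act_sum)
  qed
  finally show "ract (a \<star> b) h \<tau> = ract b (ract a h) \<tau>" by (simp add: slash_ring_def)
qed

section \<open>The norm element N and the relation between S and T^-1\<close>

definition norm_elt :: "real^2^2 \<Rightarrow>\<^sub>0 int" where
  "norm_elt = (\<Sum>j<l. gr_of (hecke_V l [^]\<^bsub>SL2R\<^esub> j))"

lemma keys_norm_elt: "Poly_Mapping.keys norm_elt \<subseteq> hecke_group l"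
  unfolding norm_elt_def
  by (intro order_trans[OF keys_sum] UN_least) (simp add: hecke_V_pow_in_group)

lemma ract_norm_elt: "ract norm_elt h \<tau> = (\<Sum>j<l. act (hecke_V l [^]\<^bsub>SL2R\<^esub> j) h \<tau>)"
  by (simp add: norm_elt_def ract_sum ract_single)

lemma ract_linear:
  assumes "Poly_Mapping.keys a \<subseteq> hecke_group l"
  shows "ract a (\<lambda>\<sigma>. f \<sigma> - g \<sigma>) \<tau> = ract a f \<tau> - ract a g \<tau>"
    and "ract a (\<lambda>\<sigma>. 0) \<tau> = 0"
proof -
  have *: "act x (\<lambda>\<sigma>. f \<sigma> - g \<sigma>) \<tau> = act x f \<tau> - act x g \<tau>
      \<and> act x (\<lambda>\<sigma>. 0) \<tau> = 0" if "x \<in> Poly_Mapping.keys a" for x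
  proof -
    have "x \<in> hecke_group l" using that assms by blast
    then obtain d \<sigma> where "\<And>h. act x h \<tau> = d * h \<sigma>" using act_pointwise by blast
    then show ?thesis by (simp add: algebra_simps)
  qed
  show "ract a (\<lambda>\<sigma>. f \<sigma> - g \<sigma>) \<tau> = ract a f \<tau> - ract a g \<tau>"
    "ract a (\<lambda>\<sigma>. 0) \<tau> = 0"
    by (simp_all add: slash_ring_def * right_diff_distrib sum_subtractf)
qed

text \<open>As \<open>l\<close> is even, the sign in V^l = (-U)^l disappears and U^l = -I
  remains.\<close>

lemma act_V_pow_l: "act (hecke_V l [^]\<^bsub>SL2R\<^esub> l) h = h"
proof -
  have "even l" using l(2) by presburger
  then have "hecke_V l [^]\<^bsub>SL2R\<^esub> l = (-1) *\<^sub>R mat 1"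
    using l(1) by (simp add: hecke_V_pow Upow_l)
  then show ?thesis by (simp only: act_minus_one)
qed

text \<open>Multiplying by V shifts the exponents to 1, ..., l; the new term V^l acts like the lost
  term 1.\<close>

lemma ract_norm_elt_V: "ract norm_elt (act (hecke_V l) h) = ract norm_elt h"
proof
  fix \<tau>
  have comm: "hecke_V l ** hecke_V l [^]\<^bsub>SL2R\<^esub> j = hecke_V l [^]\<^bsub>SL2R\<^esub> Suc j" for j
    using monoid.nat_pow_Suc2[OF group.is_monoid[OF group_SL2R], of "hecke_V l" j]
    by (simp add: hecke_V_m2)
  have "ract norm_elt (act (hecke_V l) h) \<tau> = (\<Sum>j<l. act (hecke_V l [^]\<^bsub>SL2R\<^esub> Suc j) h \<tau>)"
    unfolding ract_norm_elt comm[symmetric]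
    by (simp only: act_mult hecke_V_in_group hecke_V_pow_in_group)
  also have "\<dots> = ract norm_elt h \<tau>"
    using sum.lessThan_Suc_shift[of "\<lambda>j. act (hecke_V l [^]\<^bsub>SL2R\<^esub> j) h \<tau>" l]
      sum.lessThan_Suc[of "\<lambda>j. act (hecke_V l [^]\<^bsub>SL2R\<^esub> j) h \<tau>" l]
    by (simp add: ract_norm_elt act_V_pow_l act_one del: nat_pow_Suc)
  finally show "ract norm_elt (act (hecke_V l) h) \<tau> = ract norm_elt h \<tau>" .
qed

text \<open>T^-1 V = S, so this is V N = N applied to h | T^-1.\<close>

lemma ract_norm_elt_S: "ract norm_elt (act hecke_S h) = ract norm_elt (act (inv\<^bsub>SL2R\<^esub> (hecke_T l)) h)"
  using ract_norm_elt_V[of "act (inv\<^bsub>SL2R\<^esub> (hecke_T l)) h"]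
  by (simp add: hecke_V_def act_mult hecke_group_gens act_T_T_inv)

text \<open>The group ring element inside \<open>r_fun\<close>, isolated so that it can act on
  functions other than \<open>gauss_fun\<close>.\<close>

definition period_elt :: "real^2^2 \<Rightarrow> (real^2^2 \<Rightarrow>\<^sub>0 int)" where
  "period_elt \<gamma> = (gr_of (inv\<^bsub>SL2R\<^esub> (hecke_T l)) - gr_of (mat 1)) \<star> norm_elt \<star> gr_of \<gamma>"

lemma keys_T_inv_diff:
  "Poly_Mapping.keys (gr_of (inv\<^bsub>SL2R\<^esub> (hecke_T l)) - gr_of (mat 1)) \<subseteq> hecke_group l"
  by (rule order_trans[OF keys_diff]) (simp add: hecke_T_inv_in_group hecke_group_gens)

lemma keys_period_elt: "\<gamma> \<in> hecke_group l \<Longrightarrow> Poly_Mapping.keys (period_elt \<gamma>) \<subseteq> hecke_group l"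
  unfolding period_elt_def by (intro keys_gr_mult keys_T_inv_diff keys_norm_elt) simp

lemma ract_period_elt:
  assumes "\<gamma> \<in> hecke_group l"
  shows "ract (period_elt \<gamma>) h
    = act \<gamma> (ract norm_elt (\<lambda>\<sigma>. h (to_uhp (of_uhp \<sigma> - of_real (hecke_lambda l))) - h \<sigma>))"
proof -
  have "ract (gr_of (inv\<^bsub>SL2R\<^esub> (hecke_T l)) - gr_of (mat 1)) h
      = (\<lambda>\<sigma>. h (to_uhp (of_uhp \<sigma> - of_real (hecke_lambda l))) - h \<sigma>)"
    by (simp add: fun_eq_iff ract_diff ract_single act_T_inv act_one)
  moreover have "ract (gr_of \<gamma>) f = act \<gamma> f" for f by (simp add: fun_eq_iff ract_single)
  ultimately show ?thesis
    using assms
    by (simp add: period_elt_def ract_mult keys_gr_mult keys_T_inv_diff keys_norm_elt)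
qed

lemma ract_period_elt_S:
  assumes "\<gamma> \<in> hecke_group l"
  shows "ract (period_elt \<gamma>) (act hecke_S h) \<tau> = - ract (period_elt \<gamma>) h \<tau>"
proof -
  let ?Ti = "act (inv\<^bsub>SL2R\<^esub> (hecke_T l))"
  have *: "ract (period_elt \<gamma>) h = act \<gamma> (ract norm_elt (\<lambda>\<sigma>. ?Ti h \<sigma> - h \<sigma>))" for h
    by (simp add: ract_period_elt[OF assms] act_T_inv)
  \<comment> \<open>In front of N, S and T^-1 are interchangeable: S T^-1 N = S S N = N and S N =
    T^-1 N, so the two terms of the difference trade places.\<close>
  have "ract norm_elt (\<lambda>\<sigma>. ?Ti (act hecke_S h) \<sigma> - act hecke_S h \<sigma>)
      = (\<lambda>\<sigma>. - ract norm_elt (\<lambda>\<sigma>. ?Ti h \<sigma> - h \<sigma>) \<sigma>)"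
    by (simp add: fun_eq_iff ract_linear keys_norm_elt ract_norm_elt_S act_SS
          flip: ract_norm_elt_S[of "act hecke_S h"])
  moreover obtain d \<sigma> where "\<And>h. act \<gamma> h \<tau> = d * h \<sigma>" using act_pointwise[OF assms] by blast
  ultimately show ?thesis by (simp add: *)
qed

lemma ract_period_elt_periodic:
  assumes "\<gamma> \<in> hecke_group l"
    and "\<And>\<sigma>. h (to_uhp (of_uhp \<sigma> - of_real (hecke_lambda l))) = h \<sigma>"
  shows "ract (period_elt \<gamma>) h \<tau> = 0"
proof -
  obtain d \<sigma> where "\<And>h. act \<gamma> h \<tau> = d * h \<sigma>" using act_pointwise[OF assms(1)] by blast
  then show ?thesis
    by (simp add: ract_period_elt[OF assms(1)] assms(2) ract_linear(2) keys_norm_elt)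
qed

text \<open>The coefficients and points are chosen before \<open>h\<close>, so when \<open>h\<close>
  depends on a parameter, integrals and derivatives in it can be taken term by term.\<close>

lemma ract_pointwise:
  assumes "Poly_Mapping.keys a \<subseteq> hecke_group l"
  obtains c \<sigma> where "\<And>h. ract a h \<tau> = (\<Sum>g\<in>Poly_Mapping.keys a. c g * h (\<sigma> g))"
proof -
  have "\<forall>g\<in>Poly_Mapping.keys a. \<exists>c \<sigma>. \<forall>h. act g h \<tau> = c * h \<sigma>"
    using assms act_pointwise by blast
  then obtain c \<sigma> where "\<And>g h. g \<in> Poly_Mapping.keys a \<Longrightarrow> act g h \<tau> = c g * h (\<sigma> g)"
    by metis
  then have "ract a h \<tau> = (\<Sum>g\<in>Poly_Mapping.keys a. (of_int (Poly_Mapping.lookup a g) * c g) * h (\<sigma> g))" for h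
    by (simp add: slash_ring_def mult_ac)
  then show ?thesis by (rule that)
qed

end

section \<open>The eigenfunction property and the vanishing derivatives\<close>

text \<open>The inversion t to -1/t from the Gaussian transform is the action of S up to the sign
  \<open>\<eta>\<close>, which moves across because \<open>\<eta>\<close> squares to 1. For
  \<open>\<eta>\<close> = -\<open>\<epsilon>\<close> this is the transformation law behind the
  eigenvalue.\<close>

lemma fourier_gauss_fun:
  fixes \<xi> :: "real^2" and \<eta> :: complex and \<sigma> :: uhp and k :: nat
  assumes "l \<ge> 6" "l mod 4 = 2" "\<eta> \<in> {1, -1}"
  defines "g \<equiv> \<lambda>x. gauss_fun k x \<sigma> * exp (2 * of_real pi * \<i> * of_real (x \<bullet> \<xi>))"
  shows "integrable lborel g"
    and "integral\<^sup>L lborel g = \<eta> * slash l \<eta> (2 * int k + 1) hecke_S (gauss_fun k \<xi>) \<sigma>"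
proof -
  interpret hecke_slash l \<eta> "2 * int k + 1" by unfold_locales (use assms in auto)
  define t where "t = of_uhp \<sigma>"
  have t: "0 < Im t" "t \<noteq> 0" using of_uhp_Im of_uhp_nonzero by (simp_all add: t_def)
  note F = gauss_fourier[OF t(1), of \<xi>]
  have g: "g = (\<lambda>x. (exp (\<i> * of_real pi * t * of_real ((norm x)\<^sup>2))
      * exp (2 * of_real pi * \<i> * of_real (x \<bullet> \<xi>))) / (\<i> * of_real pi * t) ^ k)"
    by (simp add: g_def gauss_fun_def t_def)
  show "integrable lborel g" unfolding g by (intro integrable_divide F(1))
  define E where "E = exp (\<i> * of_real pi * (- 1 / t) * of_real ((norm \<xi>)\<^sup>2))"
  have int: "integral\<^sup>L lborel g = \<i> / t * E / (\<i> * of_real pi * t) ^ k"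
    unfolding g integral_divide_zero F(2) E_def ..
  have act: "\<eta> * act hecke_S (gauss_fun k \<xi>) \<sigma>
      = (\<eta> * \<eta>) * ((\<i> / t) powi (2 * int k + 1) / (\<i> * of_real pi * (- 1 / t)) ^ k) * E"
    unfolding act_S gauss_fun_def of_uhp_to_uhp_S t_def E_def by simp
  have eta2: "\<eta> * \<eta> = 1" using eta by auto
  \<comment> \<open>The weight 2k + 1 supplies the \<open>\<i> / t\<close> of the plane and k
    further squares, each of which turns one factor 1/(i pi (-1/t)) into 1/(i pi t).\<close>
  have weight: "(\<i> / t) powi (2 * int k + 1) / (\<i> * of_real pi * (- 1 / t)) ^ k
      = \<i> / t / (\<i> * of_real pi * t) ^ k"
  proof -
    have power: "z ^ (2 * k + 1) / w ^ k = z * (z\<^sup>2 / w) ^ k" for z w :: complex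
      by (simp add: power_mult power_divide)
    have "2 * int k + 1 = int (2 * k + 1)" by simp
    then have "(\<i> / t) powi (2 * int k + 1) = (\<i> / t) ^ (2 * k + 1)"
      by (simp only: power_int_of_nat)
    also have "\<dots> / (\<i> * of_real pi * (- 1 / t)) ^ k
        = \<i> / t * ((\<i> / t)\<^sup>2 / (\<i> * of_real pi * (- 1 / t))) ^ k"
      by (rule power)
    also have "(\<i> / t)\<^sup>2 / (\<i> * of_real pi * (- 1 / t)) = 1 / (\<i> * of_real pi * t)"
      using t by (simp add: field_simps power2_eq_square)
    finally show ?thesis by (simp add: power_divide)
  qed
  show "integral\<^sup>L lborel g = \<eta> * act hecke_S (gauss_fun k \<xi>) \<sigma>"
    unfolding int act eta2 weight by simp
qed

section \<open>Derivatives with respect to u = |x|^2\<close>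

text \<open>The j-th derivative at s of the radial profile of \<open>gauss_fun k\<close>. Keeping
  both powers uncancelled gives one formula for all j.\<close>

definition gauss_deriv :: "nat \<Rightarrow> nat \<Rightarrow> real \<Rightarrow> uhp \<Rightarrow> complex" where
  "gauss_deriv k j s \<tau> = exp (\<i> * of_real pi * of_uhp \<tau> * of_real s)
    * (\<i> * of_real pi * of_uhp \<tau>) ^ j / (\<i> * of_real pi * of_uhp \<tau>) ^ k"

lemma gauss_deriv_0: "gauss_deriv k 0 ((norm x)\<^sup>2) = gauss_fun k x"
  by (simp add: gauss_deriv_def gauss_fun_def fun_eq_iff)

lemma gauss_deriv_Suc:
  "((\<lambda>s. gauss_deriv k j s \<tau>) has_vector_derivative gauss_deriv k (Suc j) s \<tau>) (at s within A)"
proof -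
  define a where "a = \<i> * of_real pi * of_uhp \<tau>"
  have "((\<lambda>z. exp (a * z)) has_field_derivative exp (a * of_real s) * a) (at (of_real s))"
    by (auto intro!: derivative_eq_intros)
  then have "((\<lambda>s. exp (a * of_real s)) has_vector_derivative exp (a * of_real s) * a) (at s within A)"
    by (rule has_vector_derivative_real_field)
  then have "((\<lambda>s. exp (a * of_real s) * (a ^ j / a ^ k)) has_vector_derivative
      exp (a * of_real s) * a * (a ^ j / a ^ k)) (at s within A)"
    by (rule has_vector_derivative_mult_left)
  then show ?thesis by (simp add: gauss_deriv_def a_def mult.assoc)
qed

lemma hecke_lambda_pos: "l \<ge> 3 \<Longrightarrow> hecke_lambda l > 0"
  unfolding hecke_lambda_def by (intro mult_pos_pos cos_gt_zero) (auto simp: field_simps)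

text \<open>At j = k the powers cancel and a pure exponential remains; s times
  \<open>hecke_lambda l\<close> equals 2n, so the translation changes the exponent by a multiple of
  2 pi i.\<close>

lemma gauss_deriv_periodic:
  assumes "l \<ge> 3"
  shows "gauss_deriv k k (2 * real n / hecke_lambda l) (to_uhp (of_uhp \<sigma> - of_real (hecke_lambda l)))
    = gauss_deriv k k (2 * real n / hecke_lambda l) \<sigma>"
proof -
  define s where "s = 2 * real n / hecke_lambda l"
  have s: "complex_of_real (hecke_lambda l) * of_real s = 2 * of_nat n"
    using hecke_lambda_pos[OF assms] by (simp add: s_def)
  have eq: "gauss_deriv k k s \<tau> = exp (\<i> * of_real pi * of_uhp \<tau> * of_real s)" for \<tau>
    using of_uhp_nonzero[of \<tau>] by (simp add: gauss_deriv_def)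
  have u: "of_uhp (to_uhp (of_uhp \<sigma> - of_real (hecke_lambda l))) = of_uhp \<sigma> - of_real (hecke_lambda l)"
    using of_uhp_to_uhp_add[of \<sigma> "- hecke_lambda l"] by simp
  have "\<i> * of_real pi * (of_uhp \<sigma> - of_real (hecke_lambda l)) * of_real s
      = \<i> * of_real pi * of_uhp \<sigma> * of_real s - \<i> * of_real pi * (of_real (hecke_lambda l) * of_real s)"
    by (simp add: algebra_simps)
  also have "\<dots> = \<i> * of_real pi * of_uhp \<sigma> * of_real s - of_nat n * (2 * of_real pi * \<i>)"
    unfolding s by simp
  finally have "exp (\<i> * of_real pi * (of_uhp \<sigma> - of_real (hecke_lambda l)) * of_real s)
      = exp (\<i> * of_real pi * of_uhp \<sigma> * of_real s)"
    by (simp add: exp_diff exp_of_nat_mult)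
  then show ?thesis by (simp only: eq u flip: s_def)
qed

theorem theorem1p6:
  fixes l k :: nat and \<epsilon> :: complex and \<gamma> :: "real^2^2" and \<tau> :: uhp
  assumes "l \<ge> 6" and "l mod 4 = 2"
    and "\<epsilon> \<in> {1, -1}"
    and "\<gamma> \<in> hecke_group l"
  shows "fourier2 (r_fun l \<epsilon> k \<gamma> \<tau>) = (\<lambda>\<xi>. \<epsilon> * r_fun l \<epsilon> k \<gamma> \<tau> \<xi>) \<and>
    (\<forall>n::nat. has_radial_deriv k (r_fun l \<epsilon> k \<gamma> \<tau>) (2 * real n / hecke_lambda l) 0)"
proof
  interpret hecke_slash l "- \<epsilon>" "2 * int k + 1"
    by unfold_locales (use assms in auto)
  have r: "r_fun l \<epsilon> k \<gamma> \<tau> x = ract (period_elt \<gamma>) (gauss_fun k x) \<tau>" for x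
    by (simp add: r_fun_def period_elt_def norm_elt_def)
  \<comment> \<open>For fixed \<open>\<tau>\<close>, r becomes a finite combination of Gaussians in
    x with coefficients independent of x.\<close>
  obtain c \<sigma> where c: "\<And>h. ract (period_elt \<gamma>) h \<tau>
      = (\<Sum>g\<in>Poly_Mapping.keys (period_elt \<gamma>). c g * h (\<sigma> g))"
    using ract_pointwise[OF keys_period_elt[OF assms(4)]] by metis
  show "fourier2 (r_fun l \<epsilon> k \<gamma> \<tau>) = (\<lambda>\<xi>. \<epsilon> * r_fun l \<epsilon> k \<gamma> \<tau> \<xi>)"
  proof
    fix \<xi> :: "real^2"
    note F = fourier_gauss_fun[OF assms(1,2) eta, of k _ \<xi>]
    have "fourier2 (r_fun l \<epsilon> k \<gamma> \<tau>) \<xi>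
        = (LINT x|lborel. (\<Sum>g\<in>Poly_Mapping.keys (period_elt \<gamma>).
            c g * (gauss_fun k x (\<sigma> g) * exp (2 * of_real pi * \<i> * of_real (x \<bullet> \<xi>)))))"
      unfolding fourier2_def r c by (simp add: sum_distrib_right mult.assoc)
    also have "\<dots> = (\<Sum>g\<in>Poly_Mapping.keys (period_elt \<gamma>).
        c g * (- \<epsilon> * act hecke_S (gauss_fun k \<xi>) (\<sigma> g)))"
      (is "_ = ?R")
    proof -
      have "(LINT x|lborel. (\<Sum>g\<in>Poly_Mapping.keys (period_elt \<gamma>).
            c g * (gauss_fun k x (\<sigma> g) * exp (2 * of_real pi * \<i> * of_real (x \<bullet> \<xi>)))))
          = (\<Sum>g\<in>Poly_Mapping.keys (period_elt \<gamma>). (LINT x|lborel.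
            c g * (gauss_fun k x (\<sigma> g) * exp (2 * of_real pi * \<i> * of_real (x \<bullet> \<xi>)))))"
        by (intro Bochner_Integration.integral_sum integrable_mult_right F(1))
      also have "\<dots> = ?R"
        unfolding integral_mult_right_zero F(2) ..
      finally show ?thesis .
    qed
    \<comment> \<open>The same finite combination is read backwards as an action, now on the
      Gaussian transformed by S; the relation for S then contributes the second minus sign.\<close>
    also have "\<dots> = - \<epsilon> * ract (period_elt \<gamma>) (act hecke_S (gauss_fun k \<xi>)) \<tau>"
      unfolding c by (simp add: sum_distrib_left mult_ac)
    also have "\<dots> = \<epsilon> * r_fun l \<epsilon> k \<gamma> \<tau> \<xi>"
      by (simp add: ract_period_elt_S[OF assms(4)] r)
    finally show "fourier2 (r_fun l \<epsilon> k \<gamma> \<tau>) \<xi> = \<epsilon> * r_fun l \<epsilon> k \<gamma> \<tau> \<xi>" .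
  qed
  \<comment> \<open>The witness for the j-th derivative lets the same group ring element act on
    \<open>gauss_deriv k j s\<close>; \<open>gauss_deriv_Suc\<close> holds within any set, which
    covers the one-sided derivative at 0.\<close>
  show "\<forall>n. has_radial_deriv k (r_fun l \<epsilon> k \<gamma> \<tau>) (2 * real n / hecke_lambda l) 0"
    unfolding has_radial_deriv_def
  proof (intro allI exI[of _ "\<lambda>j s. ract (period_elt \<gamma>) (gauss_deriv k j s) \<tau>"] conjI impI)
    fix n
    show "r_fun l \<epsilon> k \<gamma> \<tau> x = ract (period_elt \<gamma>) (gauss_deriv k 0 ((norm x)\<^sup>2)) \<tau>" for x
      by (simp add: r gauss_deriv_0)
    show "((\<lambda>s. ract (period_elt \<gamma>) (gauss_deriv k j s) \<tau>) has_vector_derivative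
        ract (period_elt \<gamma>) (gauss_deriv k (Suc j) s) \<tau>) (at s within {0..})" for j s
      unfolding c
      by (intro has_vector_derivative_sum has_vector_derivative_mult_right gauss_deriv_Suc)
    show "ract (period_elt \<gamma>) (gauss_deriv k k (2 * real n / hecke_lambda l)) \<tau> = 0"
      using assms(1) by (intro ract_period_elt_periodic assms(4) gauss_deriv_periodic) simp
  qed
qed

end
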